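(* Let $n\ge 0$ be an integer and put $k=4n+3$. Define the function on the upper half-plane $$F_k(\tau)=\sqrt{\Delta_{2A}(\tau)}^{\,n}\,P_n\!\Bigl(\frac{G(\tau)}{\sqrt{\Delta_{2A}(\tau)}}\Bigr)\frac{C'(\tau)}{24}-\sqrt{\Delta_{2A}(\tau)}^{\,n+1}\,Q_n\!\Bigl(\frac{G(\tau)}{\sqrt{\Delta_{2A}(\tau)}}\Bigr).$$ Then $F_k$ is a quasimodular form of weight $k+1$ on $\Gamma_0(2)$, and it is a solution of the differential equation $$f''(\tau)-\frac{k+1}{4}E_{2A}(\tau)f'(\tau)+\frac{k(k+1)}{8}E_{2A}'(\tau)f(\tau)=0 .$$
   Context: Let $\tau$ lie in the upper half-plane, $q=e^{2\pi i\tau}$, and let ${}'$ denote the differential operator $(2\pi i)^{-1}\,d/d\tau=q\,d/dq$. Let $E_2(\tau)=1-24\sum_{n\ge1}\bigl(\sum_{d\mid n}d\bigr)q^n$ and let $\eta(\tau)=q^{1/24}\prod_{n\ge1}(1-q^n)$ be the Dedekind eta function. Define $\Delta_{2A}(\tau)=\eta(\tau)^8\eta(2\tau)^8$, $E_{2A}(\tau)=(E_2(\tau)+2E_2(2\tau))/3$ (equivalently $E_{2A}=\Delta_{2A}'/\Delta_{2A}$), $C(\tau)=2E_2(2\tau)-E_2(\tau)$, $D(\tau)=\eta(2\tau)^{16}/\eta(\tau)^8$, and $G(\tau)=C(\tau)^2-128D(\tau)$. Define polynomials $P_n(x)$, $Q_n(x)$ ($n\ge0$) by $P_0=1$, $P_1=x$,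 $Q_0=0$, $Q_1=1$ and, for $n\ge1$, $P_{n+1}(x)=xP_n(x)+\lambda_nP_{n-1}(x)$, $Q_{n+1}(x)=xQ_n(x)+\lambda_nQ_{n-1}(x)$, where $\lambda_n=4\frac{(4n+1)(4n+3)}{n(n+1)}$. Then $P_n$ has the parity of $n$ and $Q_n$ the opposite parity, so $\sqrt{\Delta_{2A}}^{\,n}P_n(G/\sqrt{\Delta_{2A}})$ and $\sqrt{\Delta_{2A}}^{\,n+1}Q_n(G/\sqrt{\Delta_{2A}})$ are polynomials in $G$ and $\Delta_{2A}$ (no choice of square root is involved). A quasimodular form of weight $w$ on $\Gamma_0(2)=\{\begin{pmatrix}a&b\\c&d\end{pmatrix}\in \mathrm{SL}_2(\mathbb Z): c\equiv 0 \bmod 2\}$ means a homogeneous element of degree $w$ of the graded ring $\mathbb C[E_2(\tau),C(\tau),D(\tau)]$, where $E_2, C, D$ are given degrees $2,2,4$ respectively. *)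

theory Defs
  imports "HOL-Complex_Analysis.Complex_Analysis" "HOL-Computational_Algebra.Polynomial"
begin

definition upper_half_plane :: "complex set" where
  "upper_half_plane = {\<tau>. Im \<tau> > 0}"

definition nome :: "complex \<Rightarrow> complex" where
  "nome \<tau> = exp (2 * of_real pi * \<i> * \<tau>)"

definition qderiv :: "(complex \<Rightarrow> complex) \<Rightarrow> complex \<Rightarrow> complex" where
  "qderiv f \<tau> = deriv f \<tau> / (2 * of_real pi * \<i>)"

text \<open>The series and the product over \<open>n \<ge> 1\<close> are indexed from \<open>0\<close>, with \<open>Suc n\<close> in place of \<open>n\<close>.\<close>

definition E2 :: "complex \<Rightarrow> complex" where
  "E2 \<tau> = 1 - 24 * (\<Sum>n. of_nat (\<Sum>d | d dvd Suc n. d) * nome \<tau> ^ Suc n)"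

definition dedekind_eta :: "complex \<Rightarrow> complex" where
  "dedekind_eta \<tau> = exp (2 * of_real pi * \<i> * \<tau> / 24) * (\<Prod>n. 1 - nome \<tau> ^ Suc n)"

definition Delta2A :: "complex \<Rightarrow> complex" where
  "Delta2A \<tau> = dedekind_eta \<tau> ^ 8 * dedekind_eta (2 * \<tau>) ^ 8"

definition E2A :: "complex \<Rightarrow> complex" where
  "E2A \<tau> = (E2 \<tau> + 2 * E2 (2 * \<tau>)) / 3"

definition C_form :: "complex \<Rightarrow> complex" where
  "C_form \<tau> = 2 * E2 (2 * \<tau>) - E2 \<tau>"

definition D_form :: "complex \<Rightarrow> complex" where
  "D_form \<tau> = dedekind_eta (2 * \<tau>) ^ 16 / dedekind_eta \<tau> ^ 8"

definition G_form :: "complex \<Rightarrow> complex" where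
  "G_form \<tau> = C_form \<tau> ^ 2 - 128 * D_form \<tau>"

definition lam :: "nat \<Rightarrow> complex" where
  "lam n = 4 * ((4 * of_nat n + 1) * (4 * of_nat n + 3)) / (of_nat n * (of_nat n + 1))"

fun P_poly :: "nat \<Rightarrow> complex poly" where
  "P_poly 0 = 1"
| "P_poly (Suc 0) = [:0, 1:]"
| "P_poly (Suc (Suc n)) = [:0, 1:] * P_poly (Suc n) + smult (lam (Suc n)) (P_poly n)"

fun Q_poly :: "nat \<Rightarrow> complex poly" where
  "Q_poly 0 = 0"
| "Q_poly (Suc 0) = 1"
| "Q_poly (Suc (Suc n)) = [:0, 1:] * Q_poly (Suc n) + smult (lam (Suc n)) (Q_poly n)"

text \<open>
  Homogeneous elements of degree \<open>w\<close> of \<open>\<complex>[E\<^sub>2, C, D]\<close>, with the generators in degrees 2, 2, 4: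
  linear combinations of the (finitely many) monomials of degree \<open>w\<close>, as functions on the upper
  half-plane. Values outside the upper half-plane are irrelevant.
\<close>

definition quasimodular_form_Gamma0_2 :: "nat \<Rightarrow> (complex \<Rightarrow> complex) \<Rightarrow> bool" where
  "quasimodular_form_Gamma0_2 w f \<longleftrightarrow>
     (\<exists>coef :: nat \<times> nat \<times> nat \<Rightarrow> complex. \<forall>\<tau>\<in>upper_half_plane.
        f \<tau> = (\<Sum>(a, b, c) | 2 * a + 2 * b + 4 * c = w.
                 coef (a, b, c) * E2 \<tau> ^ a * C_form \<tau> ^ b * D_form \<tau> ^ c))"

lemma finite_monomials_of_degree:
  "finite {(a, b, c). 2 * a + 2 * b + 4 * c = (w :: nat)}"
  by (rule finite_subset[of _ "{..w} \<times> {..w} \<times> {..w}"]) auto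

text \<open>
  The right-hand side of the definition of \<open>F\<^sub>k\<close>, \<open>k = 4n + 3\<close>, with a value \<open>s\<close> for the square root
  of \<open>\<Delta>\<^sub>2\<^sub>A(\<tau>)\<close>. The principal root is used in \<open>F_form\<close>; it is not continuous in \<open>\<tau>\<close>, but by
  parity the choice of the root at each point does not matter (\<open>F_form_eq\<close>).
\<close>

definition F_expr :: "nat \<Rightarrow> complex \<Rightarrow> complex \<Rightarrow> complex" where
  "F_expr n s \<tau> =
     s ^ n * poly (P_poly n) (G_form \<tau> / s) * (qderiv C_form \<tau> / 24)
     - s ^ (n + 1) * poly (Q_poly n) (G_form \<tau> / s)"

definition F_form :: "nat \<Rightarrow> complex \<Rightarrow> complex" where
  "F_form n \<tau> = F_expr n (csqrt (Delta2A \<tau>)) \<tau>"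

lemma poly_P_minus: "poly (P_poly n) (- x) = (-1) ^ n * poly (P_poly n) x"
  by (induction n rule: P_poly.induct) (auto simp: algebra_simps)

lemma poly_Q_minus: "poly (Q_poly n) (- x) = (-1) ^ (n + 1) * poly (Q_poly n) x"
  by (induction n rule: Q_poly.induct) (auto simp: algebra_simps)

lemma F_form_eq:
  assumes "s ^ 2 = Delta2A \<tau>"
  shows "F_form n \<tau> = F_expr n s \<tau>"
proof -
  have "csqrt (Delta2A \<tau>) = s \<or> csqrt (Delta2A \<tau>) = - s"
    using assms by (metis power2_csqrt power2_eq_iff)
  moreover have "F_expr n (- s) \<tau> = F_expr n s \<tau>"
  proof -
    have sq: "(-1) ^ m * ((-1) ^ m * z) = z" for m and z :: complex
      by (simp flip: mult.assoc power_mult_distrib)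
    have "(- s) ^ m * ((-1) ^ m * z) = s ^ m * z" for m z
      using sq[of m "s ^ m * z"] by (simp add: power_minus[of s] mult_ac)
    then show ?thesis
      unfolding F_expr_def by (simp only: divide_minus_right poly_P_minus poly_Q_minus)
  qed
  ultimately show ?thesis
    by (auto simp: F_form_def)
qed

end

theory Submission
  imports Defs
begin

text \<open>
  Put \<open>u\<^sub>k = q\<^sup>k / (1 - q\<^sup>k)\<close>. From \<open>u\<^sub>k u\<^sub>l = u\<^sub>k\<^sub>+\<^sub>l (1 + u\<^sub>k + u\<^sub>l)\<close> one evaluates
  \<open>\<Sum>\<^sub>k\<^sub>,\<^sub>l u\<^sub>k u\<^sub>l (F(k - l) - F(k + l))\<close> for every even \<open>F\<close> of polynomial growth. The choices
  \<open>F(x) = (\<plusminus>1)\<^sup>x x\<^sup>2\<close> and \<open>F(x) = (\<plusminus>1)\<^sup>x x\<^sup>4\<close> give, without any modular transformation,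
  \<open>C' = (E\<^sub>2\<^sub>A C - G)/4\<close>, \<open>E\<^sub>2\<^sub>A' = (E\<^sub>2\<^sub>A\<^sup>2 - C\<^sup>2)/8\<close> and \<open>X' = (E\<^sub>2\<^sub>A + C) X/2\<close> for
  \<open>X = \<Sum> k\<^sup>3 (u\<^sub>k(q) - u\<^sub>k(q\<^sup>2))\<close>; comparison of logarithmic derivatives with the eta products
  yields \<open>D = X\<close> and \<open>\<Delta>\<^sub>2\<^sub>A = D (C\<^sup>2 - 64 D)\<close>. With \<open>K = C'/24\<close> the forms satisfy \<open>F\<^sub>0 = K\<close>,
  \<open>F\<^sub>1 = G K - \<Delta>\<close>, \<open>F\<^sub>n\<^sub>+\<^sub>1 = G F\<^sub>n + \<lambda>\<^sub>n \<Delta> F\<^sub>n\<^sub>-\<^sub>1\<close>, where \<open>\<Delta> = \<Delta>\<^sub>2\<^sub>A\<close>, and by induction the ladder relation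
  \<open>C F\<^sub>n' = 12 (4n + 3) K F\<^sub>n - (n + 1) \<lambda>\<^sub>n \<Delta> F\<^sub>n\<^sub>-\<^sub>1\<close>. Differentiating it once more gives the
  differential equation multiplied by \<open>C\<^sup>2\<close>. All of this takes place in the disc \<open>|q| < 1\<close>.
\<close>

section \<open>A convolution identity for Lambert series\<close>

text \<open>At \<open>k = 0\<close> the value is \<open>1 / 0 = 0\<close>.\<close>

definition lterm :: "complex \<Rightarrow> nat \<Rightarrow> complex" where
  "lterm q k = q ^ k / (1 - q ^ k)"

lemma has_sum_diff:
  fixes f g :: "'a \<Rightarrow> complex"
  assumes "(f has_sum a) A" "(g has_sum b) A"
  shows "((\<lambda>x. f x - g x) has_sum (a - b)) A"
  using has_sum_add[OF assms(1) has_sum_uminusI[OF assms(2)]] by simp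

lemma summable_poly_geometric:
  fixes r :: real
  assumes "0 \<le> r" "r < 1"
  shows "summable (\<lambda>k. (1 + real k) ^ N * r ^ k)"
proof -
  obtain c where c: "r < c" "c < 1" using assms dense by blast
  have "(\<lambda>k. ((real k + 2) / (real k + 1)) ^ N * r) \<longlonglongrightarrow> 1 ^ N * r"
  proof (intro tendsto_intros)
    show "(\<lambda>k. (real k + 2) / (real k + 1)) \<longlonglongrightarrow> 1" by real_asymp
  qed
  then have "eventually (\<lambda>k. ((real k + 2) / (real k + 1)) ^ N * r < c) sequentially"
    using c by (auto dest: order_tendstoD(2))
  then obtain K where K: "\<And>k. k \<ge> K \<Longrightarrow> ((real k + 2) / (real k + 1)) ^ N * r < c"
    by (auto simp: eventually_at_top_linorder)
  show ?thesis
  proof (rule summable_ratio_test)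
    fix k assume "K \<le> k"
    have "norm ((1 + real (Suc k)) ^ N * r ^ Suc k)
        = (((real k + 2) / (real k + 1)) ^ N * r) * ((1 + real k) ^ N * r ^ k)"
      using assms by (simp add: power_divide add.commute)
    also have "\<dots> \<le> c * ((1 + real k) ^ N * r ^ k)"
      by (rule mult_right_mono) (use K[OF \<open>K \<le> k\<close>] assms in auto)
    finally show "norm ((1 + real (Suc k)) ^ N * r ^ Suc k) \<le> c * norm ((1 + real k) ^ N * r ^ k)"
      using assms by simp
  qed (use c in auto)
qed

lemma lterm_0 [simp]: "lterm q 0 = 0"
  by (simp add: lterm_def)

text \<open>For k >= 1 the denominator has modulus at least 1 - |q|^k >= 1 - r; at k = 0 the term is
  0. A radius r in place of |q| makes the bound uniform on discs, as termwise differentiation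
  requires.\<close>

lemma norm_lterm_le:
  assumes "norm q \<le> r" "r < 1"
  shows "norm (lterm q k) \<le> r ^ k / (1 - r)"
proof (cases "k = 0")
  case False
  have r0: "0 \<le> r" using assms(1) norm_ge_zero order_trans by blast
  have le: "norm (q ^ k) \<le> r ^ k" by (simp add: norm_power power_mono assms)
  also have "r ^ k \<le> r" using False r0 assms power_decreasing[of 1 k r] by simp
  finally have "1 - r \<le> norm (1 - q ^ k)"
    using norm_triangle_ineq2[of 1 "q ^ k"] by simp
  then show ?thesis
    unfolding lterm_def norm_divide by (intro frac_le le) (use assms r0 in auto)
qed (use assms in simp)

lemma power_neq_one:
  fixes q :: complex
  assumes "norm q < 1" "k \<ge> 1"
  shows "q ^ k \<noteq> 1"
proof
  assume "q ^ k = 1"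
  then have "norm q ^ k = 1" by (metis norm_one norm_power)
  then show False using assms power_decreasing[of 1 k "norm q"] by simp
qed

text \<open>With x = q^k and y = q^l one has 1 + u_k + u_l = (1 - x y) / ((1 - x) (1 - y)), which
  cancels the denominator of u_(k+l).\<close>

lemma lterm_mult:
  assumes "norm q < 1" "k \<ge> 1" "l \<ge> 1"
  shows "lterm q k * lterm q l = lterm q (k + l) * (1 + lterm q k + lterm q l)"
proof -
  have "q ^ k \<noteq> 1" "q ^ l \<noteq> 1" "q ^ (k + l) \<noteq> 1"
    using assms by (simp_all add: power_neq_one del: One_nat_def)
  then have "1 - q ^ k \<noteq> 0" "1 - q ^ l \<noteq> 0" "1 - q ^ k * q ^ l \<noteq> 0"
    by (auto simp: power_add)
  then show ?thesis
    unfolding lterm_def power_add by (simp add: divide_simps) algebra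
qed

text \<open>The majorant is a product of one-variable series, so it is summed first over l and then
  over k. It is taken with \<open>\<bar>M\<bar>\<close> because the sign of M is left open.\<close>

lemma summable_on_pairs:
  fixes f :: "nat \<times> nat \<Rightarrow> complex"
  assumes "0 \<le> r" "r < 1"
    and le: "\<And>k l. norm (f (k, l)) \<le> M * ((1 + real k) ^ N * r ^ k) * ((1 + real l) ^ N * r ^ l)"
  shows "f summable_on A"
proof -
  let ?a = "\<lambda>k. (1 + real k) ^ N * r ^ k"
  have "?a summable_on UNIV"
    by (rule norm_summable_imp_summable_on) (use summable_poly_geometric[OF assms(1,2)] assms(1) in simp)
  then obtain S where S: "(?a has_sum S) UNIV" by (auto simp: summable_on_def)
  have "(\<lambda>(k, l). \<bar>M\<bar> * ?a k * ?a l) summable_on UNIV"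
    unfolding UNIV_Times_UNIV[symmetric]
  proof (rule summable_on_SigmaI[where g = "\<lambda>k. \<bar>M\<bar> * ?a k * S"])
    show "((\<lambda>l. case (k, l) of (k, l) \<Rightarrow> \<bar>M\<bar> * ?a k * ?a l) has_sum \<bar>M\<bar> * ?a k * S) UNIV" for k
      unfolding prod.case by (intro has_sum_cmult_right S)
    show "(\<lambda>k. \<bar>M\<bar> * ?a k * S) summable_on UNIV"
      using S by (intro summable_on_cmult_left summable_on_cmult_right) (auto simp: summable_on_def)
  qed (use assms in auto)
  then have "(\<lambda>x. norm (f x)) summable_on UNIV"
  proof (rule Infinite_Sum.abs_summable_on_comparison_test')
    fix x :: "nat \<times> nat"
    obtain k l where x: "x = (k, l)" by (cases x)
    have "M * (?a k * ?a l) \<le> \<bar>M\<bar> * (?a k * ?a l)"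
      by (intro mult_right_mono) (use assms in auto)
    then show "norm (f x) \<le> (case x of (k, l) \<Rightarrow> \<bar>M\<bar> * ?a k * ?a l)"
      unfolding x using le[of k l] by (simp only: prod.case mult.assoc)
  qed
  then show ?thesis
    by (rule summable_on_subset[OF Infinite_Sum.abs_summable_summable]) auto
qed

lemma summable_on_lterm:
  assumes "norm q < 1" and c: "\<And>k. norm (c k) \<le> M * (1 + real k) ^ N"
  shows "(\<lambda>k. c k * lterm q k) summable_on A"
proof -
  have "(\<lambda>k. norm (c k * lterm q k)) summable_on UNIV"
  proof (rule Infinite_Sum.abs_summable_on_comparison_test')
    show "(\<lambda>k. ((1 + real k) ^ N * norm q ^ k) * (M / (1 - norm q))) summable_on UNIV"
      by (intro summable_on_cmult_left norm_summable_imp_summable_on)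
        (use summable_poly_geometric[of "norm q" N] assms in simp)
    show "norm (c k * lterm q k) \<le> ((1 + real k) ^ N * norm q ^ k) * (M / (1 - norm q))" for k
      using mult_mono[OF c[of k] norm_lterm_le[of q "norm q" k]] assms order_trans[OF norm_ge_zero c[of k]]
      by (simp add: norm_mult mult_ac)
  qed
  then show ?thesis
    by (rule summable_on_subset[OF Infinite_Sum.abs_summable_summable]) auto
qed

text \<open>Reindexing by m = k + l cuts the quadrant into the finite segments 1 <= k < m.\<close>

lemma has_sum_pairs_by_total:
  fixes f :: "nat \<Rightarrow> nat \<Rightarrow> complex"
  assumes "((\<lambda>(k, l). f k (k + l)) has_sum S) ({1..} \<times> {1..})"
  shows "((\<lambda>m. \<Sum>k = 1..<m. f k m) has_sum S) {1..}"
proof -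
  have "((\<lambda>(m, k). f k m) has_sum S) (Sigma {1..} (\<lambda>m. {1..<m}))
     \<longleftrightarrow> ((\<lambda>(k, l). f k (k + l)) has_sum S) ({1..} \<times> {1..})"
    by (rule has_sum_reindex_bij_witness[where i = "\<lambda>(k, l). (k + l, k)" and j = "\<lambda>(m, k). (k, m - k)"]) auto
  then have "((\<lambda>(m, k). f k m) has_sum S) (Sigma {1..} (\<lambda>m. {1..<m}))"
    using assms by simp
  then show ?thesis
    by (rule has_sum_SigmaD) (simp add: has_sum_finite)
qed

text \<open>
  By \<open>lterm_mult\<close> the products with \<open>k + l = m\<close> reduce to single sums and those with \<open>k - l = m\<close> telescope.
\<close>

lemma lterm_convolution:
  assumes q: "norm q < 1" and F: "\<And>k. norm (F k) \<le> (1 + real k) ^ N"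
  defines "u \<equiv> lterm q"
  shows "infsum (\<lambda>(k, l). u k * u l * (F (if l \<le> k then k - l else l - k) - F (k + l))) ({1..} \<times> {1..})
    = F 0 * infsum (\<lambda>k. u k ^ 2) {1..}
      + infsum (\<lambda>m. F m * (2 * u m ^ 2 - (of_nat m - 1) * u m)) {1..}
      - 2 * infsum (\<lambda>l. (\<Sum>m = 1..<l. F m) * u l) {1..}"
proof -
  define r where "r = norm q"
  have r: "0 \<le> r" "r < 1" using q by (auto simp: r_def)
  let ?D = "{1..} \<times> {1..} :: (nat \<times> nat) set"
  let ?d = "\<lambda>k l. if l \<le> k then k - l else l - k :: nat"
  have u: "norm (u k) \<le> r ^ k / (1 - r)" for k
    unfolding u_def using norm_lterm_le[of q r k] r by (simp add: r_def)
  \<comment> \<open>Since 1 + k + l <= (1 + k) (1 + l), the growth of F at any index up to k + l is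
    dominated by a product of a function of k and a function of l.\<close>
  have F': "norm (F m) \<le> (1 + real k) ^ N * (1 + real l) ^ N" if "m \<le> k + l" for k l m
  proof -
    have "norm (F m) \<le> (1 + real m) ^ N" by (rule F)
    also have "\<dots> \<le> ((1 + real k) * (1 + real l)) ^ N"
    proof (rule power_mono)
      have "real m \<le> real k + real l" using that by linarith
      moreover have "0 \<le> real k * real l" by simp
      ultimately show "1 + real m \<le> (1 + real k) * (1 + real l)"
        unfolding ring_distribs mult_1_left mult_1_right by linarith
    qed auto
    finally show ?thesis by (simp add: power_mult_distrib)
  qed
  have bnd: "norm (u k * u l * F m) \<le> (1 / (1 - r) ^ 2) * ((1 + real k) ^ N * r ^ k) * ((1 + real l) ^ N * r ^ l)"
    if "m \<le> k + l" for k l m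
  proof -
    have "norm (u k * u l * F m) \<le> (r ^ k / (1 - r)) * (r ^ l / (1 - r)) * ((1 + real k) ^ N * (1 + real l) ^ N)"
      unfolding norm_mult by (intro mult_mono u F' that) (use r in auto)
    then show ?thesis by (simp add: power2_eq_square mult_ac)
  qed
  have bnd': "norm (F k * u (k + l)) \<le> (1 / (1 - r)) * ((1 + real k) ^ N * r ^ k) * ((1 + real l) ^ N * r ^ l)" for k l
  proof -
    have "norm (F k * u (k + l)) \<le> ((1 + real k) ^ N * (1 + real l) ^ N) * (r ^ (k + l) / (1 - r))"
      unfolding norm_mult by (intro mult_mono u F') (use r in auto)
    then show ?thesis by (simp add: power_add mult_ac)
  qed
  have "(\<lambda>(k, l). u k * u l * F (?d k l)) summable_on ?D"
    by (rule summable_on_pairs[OF r, where M = "1 / (1 - r) ^ 2" and N = N], unfold prod.case, rule bnd) auto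
  then obtain A where A: "((\<lambda>(k, l). u k * u l * F (?d k l)) has_sum A) ?D" by (auto simp: summable_on_def)
  have "(\<lambda>(k, l). u k * u l * F (k + l)) summable_on ?D"
    by (rule summable_on_pairs[OF r, where M = "1 / (1 - r) ^ 2" and N = N], unfold prod.case, rule bnd) auto
  then obtain B where B: "((\<lambda>(k, l). u k * u l * F (k + l)) has_sum B) ?D" by (auto simp: summable_on_def)
  have "(\<lambda>(k, l). F k * u (k + l)) summable_on ?D"
    by (rule summable_on_pairs[OF r, where M = "1 / (1 - r)" and N = N], unfold prod.case, rule bnd')
  then obtain Z where Z: "((\<lambda>(k, l). F k * u (k + l)) has_sum Z) ?D" by (auto simp: summable_on_def)
  \<comment> \<open>The quadrant is split by the sign of k - l. The two triangles contribute equally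
    by symmetry, and the diagonal gives the \<open>F 0\<close> term.\<close>
  define Up where "Up = {(k, l). 1 \<le> k \<and> k < (l::nat)}"
  define Lo where "Lo = {(k, l). 1 \<le> l \<and> l < (k::nat)}"
  define Di where "Di = {(k, l). 1 \<le> k \<and> k = (l::nat)}"
  have "(\<lambda>(k, l). u k * u l * F (?d k l)) summable_on Up"
    "(\<lambda>(k, l). u k * u l * F (?d k l)) summable_on Di"
    by (rule summable_on_subset[OF has_sum_imp_summable[OF A]]; auto simp: Up_def Di_def)+
  then obtain A1 A0 where A1: "((\<lambda>(k, l). u k * u l * F (?d k l)) has_sum A1) Up"
    and A0: "((\<lambda>(k, l). u k * u l * F (?d k l)) has_sum A0) Di"
    by (auto simp: summable_on_def)
  have A1': "((\<lambda>(k, l). u k * u l * F (?d k l)) has_sum A1) Lo"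
    using A1 by (subst has_sum_reindex_bij_witness[where T = Up and j = prod.swap and i = prod.swap
          and h = "\<lambda>(k, l). u k * u l * F (?d k l)"]) (auto simp: Up_def Lo_def mult_ac)
  have "((\<lambda>(k, l). u k * u l * F (?d k l)) has_sum (A1 + A1 + A0)) (Up \<union> Lo \<union> Di)"
    by (intro has_sum_Un_disjoint A1 A1' A0) (auto simp: Up_def Lo_def Di_def)
  moreover have "Up \<union> Lo \<union> Di = ?D" by (auto simp: Up_def Lo_def Di_def)
  ultimately have A_eq: "A = A1 + A1 + A0" by (intro has_sum_unique[OF A]) simp
  have "((\<lambda>k. F 0 * u k ^ 2) has_sum A0) {1..}"
    using A0 by (subst has_sum_reindex_bij_witness[where T = Di and j = "\<lambda>k. (k, k)" and i = fst
          and h = "\<lambda>(k, l). u k * u l * F (?d k l)"]) (auto simp: Di_def power2_eq_square mult_ac)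
  then have A0_eq: "A0 = F 0 * infsum (\<lambda>k. u k ^ 2) {1..}"
    using infsumI infsum_cmult_right'[of "F 0" "\<lambda>k. u k ^ 2" "{1..}"] by fastforce
  \<comment> \<open>Pairs with difference m are (l, l + m), so m becomes the outer index.\<close>
  have up: "((\<lambda>(m, l). F m * (u l * u (l + m))) has_sum A1) ?D"
    using A1 by (subst has_sum_reindex_bij_witness[where T = Up and j = "\<lambda>(m, l). (l, l + m)" and i = "\<lambda>(k, l). (l - k, k)"
          and h = "\<lambda>(k, l). u k * u l * F (?d k l)"]) (auto simp: Up_def mult_ac)
  define V where "V m = infsum (\<lambda>l. u (l + m)) {1..}" for m
  have U: "u summable_on X" for X
    unfolding u_def using summable_on_lterm[OF q, of "\<lambda>_. 1" 1 0 X] by simp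
  have V: "((\<lambda>l. u (l + m)) has_sum V m) {1..}" for m
  proof -
    have "(\<lambda>l. u (l + m)) summable_on {1..} \<longleftrightarrow> u summable_on {m+1..}"
      by (rule summable_on_reindex_bij_witness[where i = "\<lambda>l. l - m" and j = "\<lambda>l. l + m"]) auto
    then show ?thesis using U by (simp add: V_def)
  qed
  have V_eq: "infsum u {1..} = (\<Sum>l = 1..m. u l) + V m" for m
  proof -
    have "V m = infsum u {m+1..}"
      unfolding V_def by (rule infsum_reindex_bij_witness[where i = "\<lambda>l. l - m" and j = "\<lambda>l. l + m"]) auto
    moreover have "infsum u ({1..m} \<union> {m+1..}) = infsum u {1..m} + infsum u {m+1..}"
      by (rule infsum_Un_disjoint) (auto simp: U)
    moreover have "{1..m} \<union> {m+1..} = {1..}" by auto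
    ultimately show ?thesis by simp
  qed
  \<comment> \<open>\<open>lterm_mult\<close> gives u_l u_(l+m) = u_m (u_l - u_(l+m)) - u_(l+m).
    Over l the bracket telescopes to the first m terms of u, and the remainder sums to the tail
    \<open>V m\<close>.\<close>
  have row: "((\<lambda>l. u l * u (l + m)) has_sum (u m * (\<Sum>l = 1..m. u l) - V m)) {1..}" if "m \<ge> 1" for m
  proof -
    have hs: "((\<lambda>l. u m * u l - u m * u (l + m) - u (l + m)) has_sum (u m * infsum u {1..} - u m * V m - V m)) {1..}"
      by (intro has_sum_diff has_sum_cmult_right V has_sum_infsum U)
    have eq: "u m * infsum u {1..} - u m * V m - V m = u m * (\<Sum>l = 1..m. u l) - V m"
      by (subst V_eq[of m]) (simp add: algebra_simps)
    have "u m * u l - u m * u (l + m) - u (l + m) = u l * u (l + m)" if "l \<in> {1..}" for l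
      using lterm_mult[OF q, of m l] \<open>m \<ge> 1\<close> that by (simp add: u_def algebra_simps)
    from has_sum_cong[THEN iffD1, OF this hs] show ?thesis unfolding eq .
  qed
  have A1_sum: "((\<lambda>m. F m * (u m * (\<Sum>l = 1..m. u l) - V m)) has_sum A1) {1..}"
    by (rule has_sum_SigmaD[OF up]) (unfold prod.case, intro has_sum_cmult_right row, auto)
  \<comment> \<open>Z is evaluated twice: by rows it cancels the tails \<open>V m\<close>, and by
    the total k + l, in \<open>Z_eq\<close>, it becomes the last series of the claim.\<close>
  have "((\<lambda>m. F m * V m) has_sum Z) {1..}"
    by (rule has_sum_SigmaD[OF Z]) (unfold prod.case, intro has_sum_cmult_right, use V in \<open>simp add: add.commute\<close>)
  from has_sum_add[OF A1_sum this]
  have s1: "((\<lambda>m. F m * (u m * (\<Sum>l = 1..m. u l))) has_sum (A1 + Z)) {1..}"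
    by (simp add: algebra_simps)
  have Z_eq: "infsum (\<lambda>l. (\<Sum>m = 1..<l. F m) * u l) {1..} = Z"
    using has_sum_pairs_by_total[of "\<lambda>k m. F k * u m", OF Z] by (auto intro!: infsumI simp: sum_distrib_right)
  have "((\<lambda>m. \<Sum>k = 1..<m. u k * u (m - k) * F m) has_sum B) {1..}"
    by (rule has_sum_pairs_by_total) (use B in simp)
  from has_sum_diff[OF has_sum_cmult_right[OF s1, of 2] this]
  have hs: "((\<lambda>m. 2 * (F m * (u m * (\<Sum>l = 1..m. u l))) - (\<Sum>k = 1..<m. u k * u (m - k) * F m))
      has_sum (2 * (A1 + Z) - B)) {1..}" .
  \<comment> \<open>By \<open>lterm_mult\<close> the finite convolution over k + l = m is u_m (m - 1
    + 2 (u_1 + ... + u_(m-1))). Its inner sum cancels against the first term except for l = m, which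
    leaves 2 u_m^2.\<close>
  have "2 * (F m * (u m * (\<Sum>l = 1..m. u l))) - (\<Sum>k = 1..<m. u k * u (m - k) * F m)
      = F m * (2 * u m ^ 2 - (of_nat m - 1) * u m)" if "m \<in> {1..}" for m
  proof -
    have "(\<Sum>k = 1..<m. u k * u (m - k)) = (\<Sum>k = 1..<m. u m * (1 + u k + u (m - k)))"
      by (rule sum.cong) (use lterm_mult[OF q] in \<open>auto simp: u_def\<close>)
    also have "\<dots> = u m * ((of_nat m - 1) + (\<Sum>k = 1..<m. u k) + (\<Sum>k = 1..<m. u (m - k)))"
      using that by (simp add: sum.distrib of_nat_diff flip: sum_distrib_left)
    also have "(\<Sum>k = 1..<m. u (m - k)) = (\<Sum>k = 1..<m. u k)"
      by (rule sum.reindex_bij_witness[where i = "\<lambda>k. m - k" and j = "\<lambda>k. m - k"]) auto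
    finally have *: "(\<Sum>k = 1..<m. u k * u (m - k)) = u m * ((of_nat m - 1) + 2 * (\<Sum>k = 1..<m. u k))"
      by simp
    have "{1..m} = insert m {1..<m}" using that by auto
    then have **: "(\<Sum>l = 1..m. u l) = u m + (\<Sum>k = 1..<m. u k)" by simp
    show ?thesis
      unfolding sum_distrib_right[symmetric] * ** by (simp add: algebra_simps power2_eq_square)
  qed
  from has_sum_cong[THEN iffD1, OF this hs] have X_eq: "infsum (\<lambda>m. F m * (2 * u m ^ 2 - (of_nat m - 1) * u m)) {1..} = 2 * (A1 + Z) - B"
    by (rule infsumI)
  have "((\<lambda>x. (case x of (k, l) \<Rightarrow> u k * u l * F (?d k l)) - (case x of (k, l) \<Rightarrow> u k * u l * F (k + l)))
      has_sum (A - B)) ?D"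
    by (rule has_sum_diff[OF A B])
  then have "infsum (\<lambda>(k, l). u k * u l * (F (?d k l) - F (k + l))) ?D = A - B"
    by (intro infsumI) (simp add: case_prod_unfold right_diff_distrib)
  then show ?thesis
    unfolding X_eq Z_eq A_eq A0_eq by simp
qed


section \<open>Lambert series twisted by a sign, and their quadratic relations\<close>

definition lsum :: "complex \<Rightarrow> nat \<Rightarrow> complex \<Rightarrow> complex" where
  "lsum s j q = infsum (\<lambda>k. s ^ k * of_nat k ^ j * lterm q k) {1..}"

text \<open>\<open>lsum2 s (j + 1)\<close> is the image of \<open>lsum s j\<close> under \<open>q d/dq\<close>.\<close>

definition lsum2 :: "complex \<Rightarrow> nat \<Rightarrow> complex \<Rightarrow> complex" where
  "lsum2 s j q = infsum (\<lambda>k. s ^ k * of_nat k ^ j * (lterm q k + lterm q k ^ 2)) {1..}"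

lemma norm_character_power_le:
  assumes "norm s = 1"
  shows "norm (s ^ k * of_nat k ^ j :: complex) \<le> (1 + real k) ^ j"
  using assms by (simp add: norm_mult norm_power power_mono)

lemma has_sum_lsum:
  assumes "norm q < 1" "norm s = 1"
  shows "((\<lambda>k. s ^ k * of_nat k ^ j * lterm q k) has_sum lsum s j q) {1..}"
  unfolding lsum_def
  by (rule has_sum_infsum, rule summable_on_lterm[where M = 1 and N = j])
    (use assms norm_character_power_le in auto)

text \<open>Written as (1 + u_k) u_k, the term has a first factor bounded independently of k, which
  is absorbed into the coefficient.\<close>

lemma has_sum_lsum2:
  assumes "norm q < 1" "norm s = 1"
  shows "((\<lambda>k. s ^ k * of_nat k ^ j * (lterm q k + lterm q k ^ 2)) has_sum lsum2 s j q) {1..}"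
proof -
  let ?M = "1 + 1 / (1 - norm q)"
  have "(\<lambda>k. (s ^ k * of_nat k ^ j * (1 + lterm q k)) * lterm q k) summable_on {1..}"
  proof (rule summable_on_lterm[OF assms(1), where M = ?M and N = j])
    fix k
    have "norm (lterm q k) \<le> norm q ^ k / (1 - norm q)"
      using norm_lterm_le assms by blast
    also have "\<dots> \<le> 1 / (1 - norm q)"
      using assms by (intro divide_right_mono) (auto simp: power_le_one)
    finally have "norm (1 + lterm q k) \<le> ?M"
      using norm_triangle_ineq[of 1 "lterm q k"] by simp
    from mult_mono[OF norm_character_power_le[OF assms(2), of k j] this]
    show "norm (s ^ k * of_nat k ^ j * (1 + lterm q k)) \<le> ?M * (1 + real k) ^ j"
      by (simp add: norm_mult mult_ac)
  qed
  then have "(\<lambda>k. s ^ k * of_nat k ^ j * (lterm q k + lterm q k ^ 2)) summable_on {1..}"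
    by (simp add: algebra_simps power2_eq_square)
  then show ?thesis unfolding lsum2_def by (rule has_sum_infsum)
qed

lemma has_sum_lsum_product:
  assumes q: "norm q < 1" and s: "norm s = 1"
  shows "((\<lambda>(k, l). (s ^ k * of_nat k ^ i * lterm q k) * (s ^ l * of_nat l ^ j * lterm q l))
    has_sum (lsum s i q * lsum s j q)) ({1..} \<times> {1..})"
proof (rule has_sum_SigmaI[where g = "\<lambda>k. (s ^ k * of_nat k ^ i * lterm q k) * lsum s j q"])
  show "((\<lambda>l. case (k, l) of (k, l) \<Rightarrow>
      (s ^ k * of_nat k ^ i * lterm q k) * (s ^ l * of_nat l ^ j * lterm q l))
    has_sum (s ^ k * of_nat k ^ i * lterm q k) * lsum s j q) {1..}" for k
    unfolding prod.case by (intro has_sum_cmult_right has_sum_lsum assms)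
  show "((\<lambda>k. (s ^ k * of_nat k ^ i * lterm q k) * lsum s j q) has_sum (lsum s i q * lsum s j q)) {1..}"
    by (intro has_sum_cmult_left has_sum_lsum assms)
  let ?r = "norm q"
  show "(\<lambda>(k, l). (s ^ k * of_nat k ^ i * lterm q k) * (s ^ l * of_nat l ^ j * lterm q l))
    summable_on ({1..} \<times> {1..})"
  proof (rule summable_on_pairs[where r = ?r and M = "1 / (1 - ?r) ^ 2" and N = "i + j"])
    fix k l
    have u: "norm (s ^ k * of_nat k ^ i * lterm q k) \<le> (1 + real k) ^ (i + j) * (?r ^ k / (1 - ?r))" if "i \<le> N" "N = i + j" for i j k N
    proof -
      have "norm (s ^ k * of_nat k ^ i * lterm q k) \<le> (1 + real k) ^ i * (?r ^ k / (1 - ?r))"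
        unfolding norm_mult[of _ "lterm q k"]
        by (intro mult_mono norm_character_power_le norm_lterm_le s) (use q in auto)
      also have "\<dots> \<le> (1 + real k) ^ (i + j) * (?r ^ k / (1 - ?r))"
        by (intro mult_right_mono power_increasing) (use q in auto)
      finally show ?thesis .
    qed
    have "norm ((s ^ k * of_nat k ^ i * lterm q k) * (s ^ l * of_nat l ^ j * lterm q l))
      \<le> ((1 + real k) ^ (i + j) * (?r ^ k / (1 - ?r))) * ((1 + real l) ^ (i + j) * (?r ^ l / (1 - ?r)))"
      unfolding norm_mult[of "s ^ k * of_nat k ^ i * lterm q k"]
      using u[of i "i + j" j k] u[of j "j + i" i l] q by (intro mult_mono) (auto simp: add.commute)
    then show "norm (case (k, l) of (k, l) \<Rightarrow> (s ^ k * of_nat k ^ i * lterm q k) * (s ^ l * of_nat l ^ j * lterm q l))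
       \<le> 1 / (1 - ?r) ^ 2 * ((1 + real k) ^ (i + j) * ?r ^ k) * ((1 + real l) ^ (i + j) * ?r ^ l)"
      by (simp add: power2_eq_square mult_ac)
  qed (use q in auto)
qed

text \<open>The choice F(m) = s^m m^i. As s^2 = 1, both s^|k-l| and s^(k+l) equal s^k s^l, so the
  sign splits over the factors; i > 0 makes \<open>F 0\<close> vanish. A separate name for
  \<open>Suc i\<close> lets instances carry plain numerals.\<close>

lemma lterm_convolution_power:
  assumes q: "norm q < 1" and s: "s = 1 \<or> s = -1" and i: "even i" "i > 0" and k: "k = Suc i"
  shows "infsum (\<lambda>(k, l). (s ^ k * lterm q k) * (s ^ l * lterm q l)
        * ((of_nat k - of_nat l) ^ i - (of_nat k + of_nat l) ^ i)) ({1..} \<times> {1..})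
    = 2 * lsum2 s i q - lsum s k q - lsum s i q
      - 2 * infsum (\<lambda>l. (\<Sum>m = 1..<l. s ^ m * of_nat m ^ i) * lterm q l) {1..}"
proof -
  note [simp] = k
  have s1: "norm s = 1" using s by auto
  have ss: "s * s = 1" using s by auto
  let ?F = "\<lambda>m. s ^ m * of_nat m ^ i"
  let ?u = "lterm q"
  have sd: "s ^ (k - l) = s ^ k * s ^ l" if "l \<le> k" for k l
  proof -
    have "s ^ k = s ^ (k - l) * s ^ l" using that by (simp flip: power_add)
    then have "s ^ k * s ^ l = s ^ (k - l) * (s * s) ^ l" by (simp add: power_mult_distrib)
    then show ?thesis using ss by simp
  qed
  have F_diff: "?F (if l \<le> k then k - l else l - k) = s ^ k * s ^ l * (of_nat k - of_nat l) ^ i" for k l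
  proof (cases "l \<le> k")
    case False
    have "(of_nat l - of_nat k :: complex) ^ i = (of_nat k - of_nat l) ^ i"
      using i(1) by (metis minus_diff_eq power_minus_even)
    then show ?thesis using False sd[of k l] by (simp add: of_nat_diff mult_ac)
  qed (simp add: sd of_nat_diff)
  have "((\<lambda>m. 2 * (?F m * (?u m + ?u m ^ 2)) - s ^ m * of_nat m ^ (Suc i) * ?u m - ?F m * ?u m)
      has_sum (2 * lsum2 s i q - lsum s (Suc i) q - lsum s i q)) {1..}"
    by (intro has_sum_diff has_sum_cmult_right has_sum_lsum has_sum_lsum2 q s1)
  moreover have "2 * (?F m * (?u m + ?u m ^ 2)) - s ^ m * of_nat m ^ (Suc i) * ?u m - ?F m * ?u m
      = ?F m * (2 * ?u m ^ 2 - (of_nat m - 1) * ?u m)" for m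
    by (simp add: algebra_simps)
  ultimately have X: "infsum (\<lambda>m. ?F m * (2 * ?u m ^ 2 - (of_nat m - 1) * ?u m)) {1..}
      = 2 * lsum2 s i q - lsum s (Suc i) q - lsum s i q"
    by (intro infsumI) simp
  have "infsum (\<lambda>(k, l). ?u k * ?u l * (?F (if l \<le> k then k - l else l - k) - ?F (k + l))) ({1..} \<times> {1..})
    = ?F 0 * infsum (\<lambda>k. ?u k ^ 2) {1..}
      + infsum (\<lambda>m. ?F m * (2 * ?u m ^ 2 - (of_nat m - 1) * ?u m)) {1..}
      - 2 * infsum (\<lambda>l. (\<Sum>m = 1..<l. ?F m) * ?u l) {1..}"
    by (rule lterm_convolution[OF q norm_character_power_le[OF s1]])
  moreover have "(\<lambda>(k, l). ?u k * ?u l * (?F (if l \<le> k then k - l else l - k) - ?F (k + l)))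
      = (\<lambda>(k, l). (s ^ k * ?u k) * (s ^ l * ?u l)
        * ((of_nat k - of_nat l) ^ i - (of_nat k + of_nat l) ^ i))"
    unfolding F_diff by (auto simp: fun_eq_iff power_add algebra_simps)
  moreover have "?F 0 = 0" using i by simp
  ultimately show ?thesis unfolding X k by (simp only: mult_zero_left add_0_left)
qed

text \<open>This and the next three closed forms are polynomials, up to sign, in the exclusive upper
  bound L = \<open>Suc l\<close>; multiplied by u_L and summed over L they become combinations of
  \<open>lsum\<close>.\<close>

lemma sum_squares_below: "(\<Sum>m = 1..<Suc l. of_nat m ^ 2) = (2 * of_nat (Suc l) ^ 3 - 3 * of_nat (Suc l) ^ 2 + of_nat (Suc l)) / (6 :: complex)"
  by (induction l) (simp_all add: field_simps power3_eq_cube power2_eq_square)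

lemma sum_fourth_powers_below:
  "(\<Sum>m = 1..<Suc l. of_nat m ^ 4) = (6 * of_nat (Suc l) ^ 5 - 15 * of_nat (Suc l) ^ 4 + 10 * of_nat (Suc l) ^ 3 - of_nat (Suc l)) / (30 :: complex)"
  by (induction l) (simp_all add: field_simps eval_nat_numeral)

lemma alternating_sum_squares_below:
  "(\<Sum>m = 1..<Suc l. (-1) ^ m * of_nat m ^ 2) = (-1) ^ Suc l * (of_nat (Suc l) - of_nat (Suc l) ^ 2) / (2 :: complex)"
  by (induction l) (simp_all add: field_simps power2_eq_square)

lemma alternating_sum_fourth_powers_below:
  "(\<Sum>m = 1..<Suc l. (-1) ^ m * of_nat m ^ 4)
    = (-1) ^ Suc l * (2 * of_nat (Suc l) ^ 3 - of_nat (Suc l) ^ 4 - of_nat (Suc l)) / (2 :: complex)"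
  by (induction l) (simp_all add: field_simps eval_nat_numeral)

lemma infsum_lterm_eqI:
  assumes "\<And>l. f (Suc l) = g (Suc l)" "((\<lambda>l. g l * lterm q l) has_sum S) {1..}"
  shows "infsum (\<lambda>l. f l * lterm q l) {1..} = S"
proof (rule infsumI)
  have "f l * lterm q l = g l * lterm q l" if "l \<in> {1..}" for l
    using assms(1)[of "l - 1"] that by simp
  from has_sum_cong[THEN iffD2, OF this assms(2)] show "((\<lambda>l. f l * lterm q l) has_sum S) {1..}" .
qed

text \<open>(k - l)^2 - (k + l)^2 = -4 k l, so the double series factors.\<close>

lemma convolution_pairs_2:
  assumes q: "norm q < 1" and s: "norm s = 1"
  shows "infsum (\<lambda>(k, l). (s ^ k * lterm q k) * (s ^ l * lterm q l)
        * ((of_nat k - of_nat l) ^ 2 - (of_nat k + of_nat l) ^ 2)) ({1..} \<times> {1..})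
      = -4 * lsum s 1 q ^ 2"
proof (rule infsumI)
  have "((\<lambda>x. -4 * (case x of (k, l) \<Rightarrow> (s ^ k * of_nat k ^ 1 * lterm q k) * (s ^ l * of_nat l ^ 1 * lterm q l)))
    has_sum (-4 * (lsum s 1 q * lsum s 1 q))) ({1..} \<times> {1..})"
    by (intro has_sum_cmult_right has_sum_lsum_product assms)
  also have "(\<lambda>x. -4 * (case x of (k, l) \<Rightarrow> (s ^ k * of_nat k ^ 1 * lterm q k) * (s ^ l * of_nat l ^ 1 * lterm q l)))
    = (\<lambda>(k, l). (s ^ k * lterm q k) * (s ^ l * lterm q l)
        * ((of_nat k - of_nat l) ^ 2 - (of_nat k + of_nat l) ^ 2))"
    by (auto simp: fun_eq_iff algebra_simps power2_eq_square)
  finally show "((\<lambda>(k, l). (s ^ k * lterm q k) * (s ^ l * lterm q l)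
        * ((of_nat k - of_nat l) ^ 2 - (of_nat k + of_nat l) ^ 2)) has_sum (-4 * lsum s 1 q ^ 2)) ({1..} \<times> {1..})"
    by (simp add: power2_eq_square)
qed

text \<open>(k - l)^4 - (k + l)^4 = -8 (k l^3 + k^3 l), a sum of two factoring double series with
  equal values.\<close>

lemma convolution_pairs_4:
  assumes q: "norm q < 1" and s: "norm s = 1"
  shows "infsum (\<lambda>(k, l). (s ^ k * lterm q k) * (s ^ l * lterm q l)
        * ((of_nat k - of_nat l) ^ 4 - (of_nat k + of_nat l) ^ 4)) ({1..} \<times> {1..})
      = -16 * lsum s 1 q * lsum s 3 q"
proof (rule infsumI)
  have "((\<lambda>x. -8 * (case x of (k, l) \<Rightarrow> (s ^ k * of_nat k ^ 1 * lterm q k) * (s ^ l * of_nat l ^ 3 * lterm q l))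
      + -8 * (case x of (k, l) \<Rightarrow> (s ^ k * of_nat k ^ 3 * lterm q k) * (s ^ l * of_nat l ^ 1 * lterm q l)))
    has_sum (-8 * (lsum s 1 q * lsum s 3 q) + -8 * (lsum s 3 q * lsum s 1 q))) ({1..} \<times> {1..})"
    by (intro has_sum_add has_sum_cmult_right has_sum_lsum_product assms)
  also have "(\<lambda>x. -8 * (case x of (k, l) \<Rightarrow> (s ^ k * of_nat k ^ 1 * lterm q k) * (s ^ l * of_nat l ^ 3 * lterm q l))
      + -8 * (case x of (k, l) \<Rightarrow> (s ^ k * of_nat k ^ 3 * lterm q k) * (s ^ l * of_nat l ^ 1 * lterm q l)))
    = (\<lambda>(k, l). (s ^ k * lterm q k) * (s ^ l * lterm q l)
        * ((of_nat k - of_nat l) ^ 4 - (of_nat k + of_nat l) ^ 4))"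
    by (auto simp: fun_eq_iff algebra_simps eval_nat_numeral)
  finally show "((\<lambda>(k, l). (s ^ k * lterm q k) * (s ^ l * lterm q l)
        * ((of_nat k - of_nat l) ^ 4 - (of_nat k + of_nat l) ^ 4)) has_sum (-16 * lsum s 1 q * lsum s 3 q)) ({1..} \<times> {1..})"
    by (simp add: mult_ac)
qed

text \<open>Ramanujan's E2' = (E2^2 - E4) / 12 in terms of Lambert series, with E4 = 1 + 240
  \<open>lsum 1 3\<close>. The series \<open>lsum 1 2\<close>, of the wrong parity, cancels.\<close>

lemma lsum_relation_2:
  assumes "norm q < 1"
  shows "6 * lsum2 1 2 q = 5 * lsum 1 3 q + lsum 1 1 q - 12 * lsum 1 1 q ^ 2"
proof -
  have "infsum (\<lambda>l. (\<Sum>m = 1..<l. 1 ^ m * of_nat m ^ 2) * lterm q l) {1..}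
    = 1 / 3 * lsum 1 3 q - 1 / 2 * lsum 1 2 q + 1 / 6 * lsum 1 1 q"
  proof (rule infsum_lterm_eqI)
    show "(\<Sum>m = 1..<Suc l. 1 ^ m * of_nat m ^ 2)
        = (\<lambda>l. 1 / 3 * (1 ^ l * of_nat l ^ 3) - 1 / 2 * (1 ^ l * of_nat l ^ 2) + 1 / 6 * (1 ^ l * of_nat l ^ 1 :: complex)) (Suc l)" for l
      unfolding power_one mult_1_left sum_squares_below by (simp add: field_simps)
    show "((\<lambda>l. (1 / 3 * (1 ^ l * of_nat l ^ 3) - 1 / 2 * (1 ^ l * of_nat l ^ 2) + 1 / 6 * (1 ^ l * of_nat l ^ 1)) * lterm q l)
      has_sum (1 / 3 * lsum 1 3 q - 1 / 2 * lsum 1 2 q + 1 / 6 * lsum 1 1 q)) {1..}"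
      unfolding left_diff_distrib distrib_right mult.assoc[of "1 / _"]
      by (intro has_sum_add has_sum_diff has_sum_cmult_right has_sum_lsum assms norm_one)
  qed
  then have "6 * infsum (\<lambda>l. (\<Sum>m = 1..<l. 1 ^ m * of_nat m ^ 2) * lterm q l) {1..}
    = 2 * lsum 1 3 q - 3 * lsum 1 2 q + lsum 1 1 q"
    by (simp only:) simp
  moreover have "-4 * lsum 1 1 q ^ 2 = 2 * lsum2 1 2 q - lsum 1 3 q - lsum 1 2 q
      - 2 * infsum (\<lambda>l. (\<Sum>m = 1..<l. 1 ^ m * of_nat m ^ 2) * lterm q l) {1..}"
    by (rule trans[OF convolution_pairs_2[symmetric] lterm_convolution_power]) (use assms in auto)
  ultimately show ?thesis by algebra
qed

text \<open>Ramanujan's E4' = (E2 E4 - E6) / 3, with E6 = 1 - 504 \<open>lsum 1 5\<close>; here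
  \<open>lsum 1 4\<close> cancels.\<close>

lemma lsum_relation_4:
  assumes "norm q < 1"
  shows "30 * lsum2 1 4 q = 21 * lsum 1 5 q + 10 * lsum 1 3 q - lsum 1 1 q - 240 * lsum 1 1 q * lsum 1 3 q"
proof -
  have "infsum (\<lambda>l. (\<Sum>m = 1..<l. 1 ^ m * of_nat m ^ 4) * lterm q l) {1..}
    = 1 / 5 * lsum 1 5 q - 1 / 2 * lsum 1 4 q + 1 / 3 * lsum 1 3 q - 1 / 30 * lsum 1 1 q"
  proof (rule infsum_lterm_eqI)
    show "(\<Sum>m = 1..<Suc l. 1 ^ m * of_nat m ^ 4)
        = (\<lambda>l. 1 / 5 * (1 ^ l * of_nat l ^ 5) - 1 / 2 * (1 ^ l * of_nat l ^ 4) + 1 / 3 * (1 ^ l * of_nat l ^ 3)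
            - 1 / 30 * (1 ^ l * of_nat l ^ 1 :: complex)) (Suc l)" for l
      unfolding power_one mult_1_left sum_fourth_powers_below by (simp add: field_simps)
    show "((\<lambda>l. (1 / 5 * (1 ^ l * of_nat l ^ 5) - 1 / 2 * (1 ^ l * of_nat l ^ 4) + 1 / 3 * (1 ^ l * of_nat l ^ 3)
            - 1 / 30 * (1 ^ l * of_nat l ^ 1)) * lterm q l)
      has_sum (1 / 5 * lsum 1 5 q - 1 / 2 * lsum 1 4 q + 1 / 3 * lsum 1 3 q - 1 / 30 * lsum 1 1 q)) {1..}"
      unfolding left_diff_distrib distrib_right mult.assoc[of "1 / _"]
      by (intro has_sum_add has_sum_diff has_sum_cmult_right has_sum_lsum assms norm_one)
  qed
  then have "30 * infsum (\<lambda>l. (\<Sum>m = 1..<l. 1 ^ m * of_nat m ^ 4) * lterm q l) {1..}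
    = 6 * lsum 1 5 q - 15 * lsum 1 4 q + 10 * lsum 1 3 q - lsum 1 1 q"
    by (simp only:) simp
  moreover have "-16 * lsum 1 1 q * lsum 1 3 q = 2 * lsum2 1 4 q - lsum 1 5 q - lsum 1 4 q
      - 2 * infsum (\<lambda>l. (\<Sum>m = 1..<l. 1 ^ m * of_nat m ^ 4) * lterm q l) {1..}"
    by (rule trans[OF convolution_pairs_4[symmetric] lterm_convolution_power]) (use assms in auto)
  ultimately show ?thesis by algebra
qed

text \<open>The alternating power sum has degree 2 instead of 3, so the coefficients differ from
  those of \<open>lsum_relation_2\<close>. The resulting independent relation permits the
  elimination in \<open>square_relation\<close>.\<close>

lemma alternating_lsum_relation_2:
  assumes "norm q < 1"
  shows "-4 * lsum (-1) 1 q ^ 2 = 2 * lsum2 (-1) 2 q - lsum (-1) 3 q - lsum (-1) 1 q"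
proof -
  have "infsum (\<lambda>l. (\<Sum>m = 1..<l. (-1) ^ m * of_nat m ^ 2) * lterm q l) {1..}
    = 1 / 2 * lsum (-1) 1 q - 1 / 2 * lsum (-1) 2 q"
  proof (rule infsum_lterm_eqI)
    show "(\<Sum>m = 1..<Suc l. (-1) ^ m * of_nat m ^ 2)
        = (\<lambda>l. 1 / 2 * ((-1) ^ l * of_nat l ^ 1) - 1 / 2 * ((-1) ^ l * of_nat l ^ 2 :: complex)) (Suc l)" for l
      unfolding alternating_sum_squares_below by (simp add: field_simps)
    show "((\<lambda>l. (1 / 2 * ((-1) ^ l * of_nat l ^ 1) - 1 / 2 * ((-1) ^ l * of_nat l ^ 2)) * lterm q l)
      has_sum (1 / 2 * lsum (-1) 1 q - 1 / 2 * lsum (-1) 2 q)) {1..}"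
      unfolding left_diff_distrib distrib_right mult.assoc[of "1 / _"]
      by (intro has_sum_add has_sum_diff has_sum_cmult_right has_sum_lsum assms) auto
  qed
  moreover have "-4 * lsum (-1) 1 q ^ 2 = 2 * lsum2 (-1) 2 q - lsum (-1) 3 q - lsum (-1) 2 q
      - 2 * infsum (\<lambda>l. (\<Sum>m = 1..<l. (-1) ^ m * of_nat m ^ 2) * lterm q l) {1..}"
    by (rule trans[OF convolution_pairs_2[symmetric] lterm_convolution_power]) (use assms in auto)
  ultimately show ?thesis by (simp only:) (simp add: algebra_simps)
qed

lemma alternating_lsum_relation_4:
  assumes "norm q < 1"
  shows "-16 * lsum (-1) 1 q * lsum (-1) 3 q = 2 * lsum2 (-1) 4 q - lsum (-1) 5 q - 2 * lsum (-1) 3 q + lsum (-1) 1 q"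
proof -
  have "infsum (\<lambda>l. (\<Sum>m = 1..<l. (-1) ^ m * of_nat m ^ 4) * lterm q l) {1..}
    = 1 * lsum (-1) 3 q - 1 / 2 * lsum (-1) 4 q - 1 / 2 * lsum (-1) 1 q"
  proof (rule infsum_lterm_eqI)
    show "(\<Sum>m = 1..<Suc l. (-1) ^ m * of_nat m ^ 4)
        = (\<lambda>l. 1 * ((-1) ^ l * of_nat l ^ 3) - 1 / 2 * ((-1) ^ l * of_nat l ^ 4) - 1 / 2 * ((-1) ^ l * of_nat l ^ 1 :: complex)) (Suc l)" for l
      unfolding alternating_sum_fourth_powers_below by (simp add: field_simps)
    show "((\<lambda>l. (1 * ((-1) ^ l * of_nat l ^ 3) - 1 / 2 * ((-1) ^ l * of_nat l ^ 4) - 1 / 2 * ((-1) ^ l * of_nat l ^ 1)) * lterm q l)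
      has_sum (1 * lsum (-1) 3 q - 1 / 2 * lsum (-1) 4 q - 1 / 2 * lsum (-1) 1 q)) {1..}"
      unfolding left_diff_distrib distrib_right mult.assoc[of "1 / _"] mult.assoc[of 1]
      by (intro has_sum_add has_sum_diff has_sum_cmult_right has_sum_lsum assms) auto
  qed
  moreover have "-16 * lsum (-1) 1 q * lsum (-1) 3 q = 2 * lsum2 (-1) 4 q - lsum (-1) 5 q - lsum (-1) 4 q
      - 2 * infsum (\<lambda>l. (\<Sum>m = 1..<l. (-1) ^ m * of_nat m ^ 4) * lterm q l) {1..}"
    by (rule trans[OF convolution_pairs_4[symmetric] lterm_convolution_power]) (use assms in auto)
  ultimately show ?thesis by (simp only:) (simp add: algebra_simps)
qed


section \<open>Differentiation, doubling of the argument, and Euler's product\<close>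

lemma lterm_has_field_derivative:
  assumes "norm x < 1"
  shows "((\<lambda>x. lterm x n) has_field_derivative (of_nat n * x ^ (n - 1) / (1 - x ^ n) ^ 2)) (at x)"
proof (cases "n = 0")
  case False
  then have "x ^ n \<noteq> 1" using power_neq_one[OF assms, of n] by simp
  then have "((\<lambda>x. x ^ n / (1 - x ^ n)) has_field_derivative (of_nat n * x ^ (n - 1) / (1 - x ^ n) ^ 2)) (at x)"
    by (auto intro!: derivative_eq_intros simp: power2_eq_square field_simps)
  then show ?thesis unfolding lterm_def .
qed simp

text \<open>Termwise differentiation by local majorants; q times the derivative of u_n is n q^n / (1
  - q^n)^2 = n (u_n + u_n^2). The derivative at 0 is recorded separately because q D says nothing
  about D there.\<close>

lemma lsum_derivative:
  assumes q: "norm q < 1" and s: "norm s = 1"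
  obtains D where "(lsum s j has_field_derivative D) (at q)" "q * D = lsum2 s (Suc j) q" "q = 0 \<Longrightarrow> D = s"
proof -
  let ?S = "ball 0 1 :: complex set"
  let ?f = "\<lambda>n x. s ^ n * of_nat n ^ j * lterm x n"
  let ?f' = "\<lambda>n x. s ^ n * of_nat n ^ j * (of_nat n * x ^ (n - 1) / (1 - x ^ n) ^ 2)"
  have UNIV_sums: "f sums A" if "(f has_sum A) {1..}" "f 0 = 0" for f :: "nat \<Rightarrow> complex" and A
  proof (rule has_sum_imp_sums)
    show "(f has_sum A) UNIV"
      by (rule has_sum_cong_neutral[THEN iffD1, OF _ _ _ that(1)]) (use that(2) in \<open>auto simp: not_less_eq_eq\<close>)
  qed
  have "\<exists>g g'. \<forall>x\<in>?S. (\<lambda>n. ?f n x) sums g x \<and> (\<lambda>n. ?f' n x) sums g' x \<and> (g has_field_derivative g' x) (at x)"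
  proof (rule series_and_derivative_comparison_local)
    show "open ?S" by simp
    show "(?f n has_field_derivative ?f' n x) (at x)" if "x \<in> ?S" for n x
      using that by (intro DERIV_cmult lterm_has_field_derivative) simp
    fix x assume "x \<in> ?S"
    then have x: "norm x < 1" by simp
    \<comment> \<open>The midpoint of |x| and 1: the ball of radius (1 - |x|) / 2 about x stays
      within |y| <= r < 1.\<close>
    define r where "r = (1 + norm x) / 2"
    have r: "0 \<le> r" "r < 1" using x by (auto simp: r_def)
    have "norm (?f n y) \<le> (1 + real n) ^ j * r ^ n * (1 / (1 - r))" if "y \<in> ball x ((1 - norm x) / 2) \<inter> ?S" for n y
    proof -
      have "norm y \<le> norm x + norm (y - x)" by (metis add.commute diff_add_cancel norm_triangle_ineq)
      also have "\<dots> \<le> r" using that by (simp add: r_def dist_norm norm_minus_commute)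
      finally have "norm (lterm y n) \<le> r ^ n / (1 - r)" by (rule norm_lterm_le[OF _ r(2)])
      then have "norm (?f n y) \<le> (1 + real n) ^ j * (r ^ n / (1 - r))"
        unfolding norm_mult[of _ "lterm y n"] using r by (intro mult_mono norm_character_power_le s) auto
      then show ?thesis by simp
    qed
    moreover have "summable (\<lambda>n. (1 + real n) ^ j * r ^ n * (1 / (1 - r)))"
      by (intro summable_mult2 summable_poly_geometric r)
    ultimately show "\<exists>d h. 0 < d \<and> summable h \<and> (\<forall>\<^sub>F n in sequentially. \<forall>y\<in>ball x d \<inter> ?S. norm (?f n y) \<le> h n)"
      using x by (intro exI[of _ "(1 - norm x) / 2"] exI[of _ "\<lambda>n. (1 + real n) ^ j * r ^ n * (1 / (1 - r))"]) auto
  qed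
  then obtain g g' where g: "\<And>x. x \<in> ?S \<Longrightarrow> (\<lambda>n. ?f n x) sums g x"
    and g': "\<And>x. x \<in> ?S \<Longrightarrow> (\<lambda>n. ?f' n x) sums g' x"
    and gd: "\<And>x. x \<in> ?S \<Longrightarrow> (g has_field_derivative g' x) (at x)" by blast
  have g_eq: "g x = lsum s j x" if "x \<in> ?S" for x
    using sums_unique2[OF g[OF that] UNIV_sums[OF has_sum_lsum[of x s j]]] that s by simp
  have qS: "q \<in> ?S" using q by simp
  have "(lsum s j has_field_derivative g' q) (at q)"
    by (rule has_field_derivative_transform_within_open[OF gd[OF qS] open_ball qS g_eq])
  moreover have "q * g' q = lsum2 s (Suc j) q"
  proof -
    have "(\<lambda>n. q * ?f' n q) sums (q * g' q)" using g'[OF qS] by (rule sums_mult)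
    moreover have "q * ?f' n q = s ^ n * of_nat n ^ Suc j * (lterm q n + lterm q n ^ 2)" for n
    proof (cases "n = 0")
      case False
      then have "1 - q ^ n \<noteq> 0" using power_neq_one[OF q, of n] by simp
      then have "lterm q n + lterm q n ^ 2 = q ^ n / (1 - q ^ n) ^ 2"
        unfolding lterm_def by (simp add: divide_simps power2_eq_square) (simp add: algebra_simps)
      moreover have "q ^ n = q * q ^ (n - 1)" using False by (simp add: power_eq_if)
      ultimately show ?thesis by simp
    qed simp
    ultimately have "(\<lambda>n. s ^ n * of_nat n ^ Suc j * (lterm q n + lterm q n ^ 2)) sums (q * g' q)" by simp
    from sums_unique2[OF this UNIV_sums[OF has_sum_lsum2[OF q s, of "Suc j"]]] show ?thesis by simp
  qed
  moreover have "g' q = s" if "q = 0"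
  proof -
    \<comment> \<open>At the origin only n = 1 survives, through \<open>0 ^ 0 = 1\<close>; the
      summand n = 0 is removed by its factor n.\<close>
    have "?f' n 0 = (if n = 1 then s else 0)" for n
      by (cases n) (auto simp: power_0_left)
    then have "(\<lambda>n. ?f' n 0) = (\<lambda>n. if n = 1 then s else 0)" by (rule ext)
    then have "(\<lambda>n. ?f' n 0) sums s" using sums_single[of 1 "\<lambda>_. s"] by simp
    then show ?thesis using sums_unique2[OF g'[OF qS]] that by simp
  qed
  ultimately show ?thesis by (rule that)
qed

lemma lsum_holomorphic [holomorphic_intros]:
  assumes "norm s = 1"
  shows "lsum s j holomorphic_on ball 0 1"
proof (rule holomorphic_onI)
  fix x :: complex assume "x \<in> ball 0 1"
  then have "norm x < 1" by simp
  from lsum_derivative[OF this assms, of j] show "lsum s j field_differentiable at x within ball 0 1"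
    by (meson field_differentiable_at_within field_differentiable_def)
qed

text \<open>(-1)^k + 1 is 2 at even k and 0 at odd k; putting k = 2 m gives the factor 2 *
  2^j.\<close>

lemma even_part_sum:
  fixes v :: "nat \<Rightarrow> complex"
  assumes A: "((\<lambda>k. (-1) ^ k * of_nat k ^ j * v k) has_sum A) {1..}"
    and B: "((\<lambda>k. 1 ^ k * of_nat k ^ j * v k) has_sum B) {1..}"
    and C: "((\<lambda>k. 1 ^ k * of_nat k ^ j * v (2 * k)) has_sum C) {1..}"
  shows "A = 2 ^ Suc j * C - B"
proof -
  have "((\<lambda>k. (-1) ^ k * of_nat k ^ j * v k + 1 ^ k * of_nat k ^ j * v k) has_sum (A + B)) {1..}"
    by (rule has_sum_add[OF A B])
  then have *: "((\<lambda>k. (-1) ^ k * of_nat k ^ j * v k + 1 ^ k * of_nat k ^ j * v k) has_sum (A + B)) {k \<in> {1..}. even k}"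
    by (rule has_sum_cong_neutral[THEN iffD1, rotated -1]) auto
  have "((\<lambda>k. 2 ^ Suc j * (1 ^ k * of_nat k ^ j * v (2 * k))) has_sum (A + B)) {1..}"
    by (rule has_sum_reindex_bij_witness[where i = "\<lambda>k. k div 2" and j = "\<lambda>k. 2 * k", THEN iffD2, OF _ _ _ _ _ refl *])
      (auto simp: power_mult_distrib)
  from has_sum_unique[OF this has_sum_cmult_right[OF C]] show ?thesis by (simp add: eq_diff_eq)
qed

lemma norm_square_less_one: "norm (q :: complex) < 1 \<Longrightarrow> norm (q ^ 2) < 1"
  by (simp add: norm_power power_less_one_iff)

lemma lterm_double: "lterm q (2 * k) = lterm (q ^ 2) k"
  by (simp add: lterm_def power_mult)

text \<open>Level 2 enters here: u_(2k) at q is u_k at q^2, so the sign twist is traded for the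
  argument q^2.\<close>

lemma lsum_alternating:
  assumes "norm q < 1"
  shows "lsum (-1) j q = 2 ^ Suc j * lsum 1 j (q ^ 2) - lsum 1 j q"
    and "lsum2 (-1) j q = 2 ^ Suc j * lsum2 1 j (q ^ 2) - lsum2 1 j q"
proof -
  note h = has_sum_lsum[OF norm_square_less_one[OF assms] norm_one, of j]
    has_sum_lsum2[OF norm_square_less_one[OF assms] norm_one, of j]
  show "lsum (-1) j q = 2 ^ Suc j * lsum 1 j (q ^ 2) - lsum 1 j q"
    by (rule even_part_sum[OF has_sum_lsum has_sum_lsum]) (use assms h in \<open>simp_all add: lterm_double\<close>)
  show "lsum2 (-1) j q = 2 ^ Suc j * lsum2 1 j (q ^ 2) - lsum2 1 j q"
    by (rule even_part_sum[OF has_sum_lsum2 has_sum_lsum2]) (use assms h in \<open>simp_all add: lterm_double\<close>)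
qed

section \<open>Euler's product, its logarithmic derivative, and the divisor sum series\<close>

definition euler_phi :: "complex \<Rightarrow> complex" where
  "euler_phi q = (\<Prod>n. 1 - q ^ Suc n)"

lemma euler_phi_convergent:
  assumes "norm q < 1"
  shows "convergent_prod (\<lambda>n. 1 - q ^ Suc n :: complex)"
proof (rule abs_convergent_prod_imp_convergent_prod, unfold abs_convergent_prod_conv_summable)
  have "summable (\<lambda>n. norm q ^ Suc n)"
    using assms by (simp add: summable_Suc_iff)
  then show "summable (\<lambda>n. norm (1 - q ^ Suc n - 1))" by (simp add: norm_power norm_mult)
qed

lemma euler_phi_nonzero:
  assumes "norm q < 1"
  shows "euler_phi q \<noteq> 0"
  unfolding euler_phi_def
  by (rule prodinf_nonzero[OF euler_phi_convergent[OF assms]])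
    (use power_neq_one[OF assms, of "Suc _"] in force)

lemma euler_phi_0 [simp]: "euler_phi 0 = 1"
  by (simp add: euler_phi_def)

lemma euler_phi_uniform_limit:
  assumes "r < 1"
  shows "uniform_limit (cball 0 r) (\<lambda>n q. \<Prod>k<n. 1 - q ^ Suc k) euler_phi sequentially"
proof -
  have "uniformly_convergent_on (cball 0 r) (\<lambda>N x. \<Prod>n<N. 1 - x ^ Suc n :: complex)"
  proof (rule uniformly_convergent_on_prod')
    show "uniformly_convergent_on (cball 0 r) (\<lambda>N x. \<Sum>n<N. norm (1 - x ^ Suc n - 1 :: complex))"
    proof (rule Weierstrass_m_test')
      \<comment> \<open>The majorant uses \<open>max 0 r\<close> since r may be negative, in which
        case the disc is empty.\<close>
      show "norm (norm (1 - x ^ Suc n - 1)) \<le> max 0 r ^ Suc n" if "x \<in> cball 0 r" for n and x :: complex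
      proof -
        have "norm x ^ Suc n \<le> max 0 r ^ Suc n" using that by (intro power_mono) auto
        then show ?thesis by (simp add: norm_power norm_mult)
      qed
      show "summable (\<lambda>n. max 0 r ^ Suc n)" using assms unfolding summable_Suc_iff by (intro summable_geometric) auto
    qed
  qed (auto intro!: continuous_intros)
  then have "uniform_limit (cball 0 r) (\<lambda>n q. \<Prod>k<n. 1 - q ^ Suc k :: complex) (\<lambda>q. lim (\<lambda>n. \<Prod>k<n. 1 - q ^ Suc k)) sequentially"
    by (simp add: uniformly_convergent_uniform_limit_iff)
  moreover have "lim (\<lambda>n. \<Prod>k<n. 1 - q ^ Suc k) = euler_phi q" if "q \<in> cball 0 r" for q
  proof -
    have q: "norm q < 1" using that assms by simp
    have "(\<lambda>n. \<Prod>k<n. 1 - q ^ Suc k) \<longlonglongrightarrow> euler_phi q"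
      unfolding euler_phi_def by (rule has_prod_imp_tendsto'[OF convergent_prod_has_prod[OF euler_phi_convergent[OF q]]])
    then show ?thesis by (rule limI)
  qed
  ultimately show ?thesis
    by (metis (no_types, lifting) uniform_limit_cong')
qed

text \<open>Locally uniform convergence allows logarithmic differentiation factor by factor; the
  factor 1 - q^k contributes -k u_k after multiplication by q.\<close>

lemma euler_phi_derivative:
  assumes q: "norm q < 1"
  shows "(euler_phi has_field_derivative deriv euler_phi q) (at q)"
    and "q * deriv euler_phi q = - lsum 1 1 q * euler_phi q"
proof -
  obtain r where r: "norm q < r" "r < 1" using q dense by blast
  have qr: "q \<in> ball 0 r" using r by simp
  have ul: "uniform_limit (cball 0 r) (\<lambda>n q. \<Prod>k<n. 1 - q ^ Suc k) euler_phi sequentially"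
    by (rule euler_phi_uniform_limit[OF r(2)])
  have "euler_phi holomorphic_on ball 0 r"
    by (rule holomorphic_uniform_limit[OF _ ul, THEN conjunct2])
      (auto intro!: always_eventually continuous_intros holomorphic_intros)
  then show "(euler_phi has_field_derivative deriv euler_phi q) (at q)"
    using qr by (intro holomorphic_derivI) auto
  have "(\<lambda>k. deriv (\<lambda>q. 1 - q ^ Suc k) q / (1 - q ^ Suc k)) sums (deriv euler_phi q / euler_phi q)"
    by (rule logderiv_prodinf_complex_uniform_limit[where A = "ball 0 r"])
      (use ul qr q euler_phi_nonzero in \<open>auto intro!: holomorphic_intros intro: uniform_limit_on_subset\<close>)
  from sums_mult[OF this, of q]
  have "(\<lambda>k. q * (deriv (\<lambda>q. 1 - q ^ Suc k) q / (1 - q ^ Suc k))) sums (q * (deriv euler_phi q / euler_phi q))" .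
  moreover have "q * (deriv (\<lambda>q. 1 - q ^ Suc k) q / (1 - q ^ Suc k)) = - (1 ^ Suc k * of_nat (Suc k) ^ 1 * lterm q (Suc k))" for k
  proof -
    have "deriv (\<lambda>q. 1 - q ^ Suc k) q = - (of_nat (Suc k) * q ^ k)"
      by (rule DERIV_imp_deriv) (rule derivative_eq_intros refl | simp)+
    then show ?thesis by (simp add: lterm_def)
  qed
  ultimately have *: "(\<lambda>k. - (1 ^ Suc k * of_nat (Suc k) ^ 1 * lterm q (Suc k))) sums (q * (deriv euler_phi q / euler_phi q))"
    by simp
  have "((\<lambda>k. 1 ^ Suc k * of_nat (Suc k) ^ 1 * lterm q (Suc k)) has_sum lsum 1 1 q) UNIV"
    by (rule has_sum_reindex_bij_witness[where i = "\<lambda>k. k - 1" and j = Suc,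
          THEN iffD2, OF _ _ _ _ _ refl has_sum_lsum[OF q norm_one]]) auto
  then have "(\<lambda>k. - (1 ^ Suc k * of_nat (Suc k) ^ 1 * lterm q (Suc k))) sums - lsum 1 1 q"
    by (intro sums_minus has_sum_imp_sums)
  from sums_unique2[OF * this] show "q * deriv euler_phi q = - lsum 1 1 q * euler_phi q"
    using euler_phi_nonzero[OF q] by (simp add: field_simps)
qed

lemma euler_phi_holomorphic [holomorphic_intros]: "euler_phi holomorphic_on ball 0 1"
  by (rule holomorphic_onI) (meson euler_phi_derivative(1) field_differentiable_at_within field_differentiable_def mem_ball_0)

text \<open>Expanding u_k as the geometric series of q^(k m) and collecting the pairs with k m = n
  gives the sum of the divisors k of n.\<close>

lemma divisor_sum_series:
  assumes q: "norm q < 1"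
  shows "(\<lambda>n. of_nat (\<Sum>d | d dvd Suc n. d) * q ^ Suc n) sums lsum 1 1 q"
proof -
  have geo: "((\<lambda>m. of_nat k * (q ^ k) ^ m) has_sum (1 ^ k * of_nat k ^ 1 * lterm q k)) {1..}" if "k \<ge> 1" for k
  proof -
    have "norm (q ^ k) < 1" using q that by (simp add: norm_power power_less_one_iff)
    from has_sum_cmult_right[OF has_sum_geometric_from_1[OF this], of "of_nat k"]
    show ?thesis by (simp add: lterm_def)
  qed
  have "(\<lambda>(k, m). of_nat k * (q ^ k) ^ m) summable_on ({1..} \<times> {1..})"
  proof (rule Infinite_Sum.abs_summable_summable, rule summable_on_SigmaI)
    show "((\<lambda>m. norm (case (k, m) of (k, m) \<Rightarrow> of_nat k * (q ^ k) ^ m))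
        has_sum (real k * (norm q ^ k / (1 - norm q ^ k)))) {1..}" if "k \<in> {1..}" for k
    proof -
      have "norm (norm q ^ k) < 1" using q that by (simp add: norm_power power_less_one_iff)
      from has_sum_cmult_right[OF has_sum_geometric_from_1[OF this], of "real k"]
      show ?thesis by (simp add: norm_mult norm_power)
    qed
    \<comment> \<open>The row sums of the norms are the terms of \<open>lsum 1 1\<close> at the real
      point |q|, which already converges there.\<close>
    have n: "norm (complex_of_real (norm q)) < 1" using q by simp
    have "(\<lambda>k. norm (1 ^ k * of_nat k ^ 1 * lterm (of_real (norm q)) k)) summable_on {1..}"
      using has_sum_imp_summable[OF has_sum_lsum[OF n norm_one, of 1]] 
      by (simp add: summable_on_iff_abs_summable_on_complex)
    moreover have "norm (1 ^ k * of_nat k ^ 1 * lterm (of_real (norm q)) k) = real k * (norm q ^ k / (1 - norm q ^ k))" for k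
    proof -
      have "lterm (of_real (norm q)) k = complex_of_real (norm q ^ k / (1 - norm q ^ k))"
        by (simp add: lterm_def)
      moreover have "0 \<le> norm q ^ k / (1 - norm q ^ k)" using q by (simp add: power_le_one)
      ultimately show ?thesis by (simp only: norm_mult norm_of_real abs_of_nonneg) simp
    qed
    ultimately show "(\<lambda>k. real k * (norm q ^ k / (1 - norm q ^ k))) summable_on {1..}" by simp
  qed auto
  from has_sum_SigmaI[OF _ has_sum_lsum[OF q norm_one] this]
  have "((\<lambda>(k, m). of_nat k * (q ^ k) ^ m) has_sum lsum 1 1 q) ({1..} \<times> {1..})"
    using geo by simp
  then have "((\<lambda>(n, d). of_nat d * q ^ n) has_sum lsum 1 1 q) (Sigma {1..} (\<lambda>n. {d. d dvd n}))"
    by (rule has_sum_reindex_bij_witness[where i = "\<lambda>(k, m). (k * m, k)" and j = "\<lambda>(n, d). (d, n div d)",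
          THEN iffD2, rotated -1])
      (auto simp: Suc_le_eq dvd_pos_nat dvd_div_eq_0_iff simp flip: power_mult intro!: Nat.gr0I)
  from has_sum_SigmaD[OF this, where g = "\<lambda>n. of_nat (\<Sum>d | d dvd n. d) * q ^ n"]
  have "((\<lambda>n. of_nat (\<Sum>d | d dvd n. d) * q ^ n) has_sum lsum 1 1 q) {1..}"
    by (simp add: sum_distrib_right has_sum_finite_iff)
  then have "((\<lambda>n. of_nat (\<Sum>d | d dvd Suc n. d) * q ^ Suc n) has_sum lsum 1 1 q) UNIV"
    by (rule has_sum_reindex_bij_witness[where i = "\<lambda>n. n - 1" and j = Suc, THEN iffD2, rotated -1]) auto
  then show ?thesis by (rule has_sum_imp_sums)
qed


section \<open>Ramanujan-type differential equations of level 2\<close>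

text \<open>The operator q d/dq as a relation: differentiability and the value are asserted
  together, so differential equations compose by introduction rules and remain meaningful at q =
  0.\<close>

definition has_theta :: "(complex \<Rightarrow> complex) \<Rightarrow> complex \<Rightarrow> complex \<Rightarrow> bool" where
  "has_theta f t q \<longleftrightarrow> (\<exists>D. (f has_field_derivative D) (at q) \<and> q * D = t)"

lemma has_theta_unique: "has_theta f t q \<Longrightarrow> has_theta f t' q \<Longrightarrow> t = t'"
  unfolding has_theta_def using DERIV_unique by blast

lemma has_theta_eqI: "has_theta f t q \<Longrightarrow> t = u \<Longrightarrow> has_theta f u q"
  by simp

lemma has_theta_const [intro]: "has_theta (\<lambda>_. c) 0 q"
  unfolding has_theta_def by (intro exI[of _ 0]) auto

lemma has_theta_add [intro]:
  "has_theta f t q \<Longrightarrow> has_theta g u q \<Longrightarrow> has_theta (\<lambda>q. f q + g q) (t + u) q"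
  unfolding has_theta_def using DERIV_add by (metis distrib_left)

lemma has_theta_diff [intro]:
  "has_theta f t q \<Longrightarrow> has_theta g u q \<Longrightarrow> has_theta (\<lambda>q. f q - g q) (t - u) q"
  unfolding has_theta_def using DERIV_diff by (metis right_diff_distrib)

lemma has_theta_mult [intro]:
  assumes "has_theta f t q" "has_theta g u q"
  shows "has_theta (\<lambda>q. f q * g q) (t * g q + f q * u) q"
proof -
  obtain D E where "(f has_field_derivative D) (at q)" "q * D = t"
    "(g has_field_derivative E) (at q)" "q * E = u"
    using assms by (auto simp: has_theta_def)
  then show ?thesis
    unfolding has_theta_def by (intro exI[of _ "D * g q + E * f q"] conjI DERIV_mult) (auto simp: algebra_simps)
qed

lemma has_theta_cmult [intro]: "has_theta f t q \<Longrightarrow> has_theta (\<lambda>q. c * f q) (c * t) q"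
  using has_theta_mult[OF has_theta_const[of c]] by simp

lemma has_theta_power [intro]:
  assumes "has_theta f t q"
  shows "has_theta (\<lambda>q. f q ^ n) (of_nat n * f q ^ (n - 1) * t) q"
proof -
  obtain D where "(f has_field_derivative D) (at q)" "q * D = t"
    using assms by (auto simp: has_theta_def)
  then show ?thesis
    unfolding has_theta_def
    by (intro exI[of _ "of_nat n * (D * f q ^ (n - 1))"] conjI) (auto intro!: derivative_eq_intros)
qed

lemma has_theta_divide [intro]:
  assumes "has_theta f t q" "has_theta g u q" "g q \<noteq> 0"
  shows "has_theta (\<lambda>q. f q / g q) ((t * g q - f q * u) / (g q * g q)) q"
proof -
  obtain D E where "(f has_field_derivative D) (at q)" "q * D = t"
    "(g has_field_derivative E) (at q)" "q * E = u"
    using assms by (auto simp: has_theta_def)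
  then show ?thesis
    unfolding has_theta_def using assms(3)
    by (intro exI[of _ "(D * g q - f q * E) / (g q * g q)"] conjI DERIV_divide) (auto simp: algebra_simps)
qed

lemma has_theta_square:
  assumes "has_theta f t (q ^ 2)"
  shows "has_theta (\<lambda>q. f (q ^ 2)) (2 * t) q"
proof -
  obtain D where D: "(f has_field_derivative D) (at (q ^ 2))" "q ^ 2 * D = t"
    using assms by (auto simp: has_theta_def)
  have "((\<lambda>q. f (q ^ 2)) has_field_derivative (D * (2 * q))) (at q)"
    by (rule DERIV_chain2[where f = f and g = "\<lambda>q. q ^ 2", OF D(1)]) (auto intro!: derivative_eq_intros)
  then show ?thesis
    unfolding has_theta_def using D(2) by (intro exI[of _ "D * (2 * q)"]) (auto simp: power2_eq_square)
qed

lemma has_theta_transform: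
  assumes "has_theta f t q" "norm q < 1" "\<And>q. norm q < 1 \<Longrightarrow> f q = g q"
  shows "has_theta g t q"
  using assms unfolding has_theta_def
  by (metis has_field_derivative_transform_within_open mem_ball_0 open_ball)

lemma has_theta_deriv:
  assumes "f holomorphic_on ball 0 1" "norm q < 1"
  shows "has_theta f (q * deriv f q) q"
  unfolding has_theta_def using holomorphic_derivI[OF assms(1) open_ball] assms(2) by auto

lemma has_theta_lsum:
  assumes "norm q < 1"
  shows "has_theta (lsum 1 j) (lsum2 1 (Suc j) q) q"
    and "has_theta (\<lambda>q. lsum 1 j (q ^ 2)) (2 * lsum2 1 (Suc j) (q ^ 2)) q"
proof -
  have *: "has_theta (lsum 1 j) (lsum2 1 (Suc j) q) q" if "norm q < 1" for q
    using lsum_derivative[OF that norm_one, of j] unfolding has_theta_def by blast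
  show "has_theta (lsum 1 j) (lsum2 1 (Suc j) q) q" by (rule *[OF assms])
  show "has_theta (\<lambda>q. lsum 1 j (q ^ 2)) (2 * lsum2 1 (Suc j) (q ^ 2)) q"
    by (rule has_theta_square[OF *[OF norm_square_less_one[OF assms]]])
qed

definition E2A_q :: "complex \<Rightarrow> complex" where
  "E2A_q q = 1 - 8 * lsum 1 1 q - 16 * lsum 1 1 (q ^ 2)"

definition C_q :: "complex \<Rightarrow> complex" where
  "C_q q = 1 + 24 * lsum 1 1 q - 48 * lsum 1 1 (q ^ 2)"

text \<open>The series X of the overview; its identification with the eta quotient is
  \<open>D_q_product\<close>.\<close>

definition D_q :: "complex \<Rightarrow> complex" where
  "D_q q = lsum 1 3 q - lsum 1 3 (q ^ 2)"

definition G_q :: "complex \<Rightarrow> complex" where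
  "G_q q = C_q q ^ 2 - 128 * D_q q"

text \<open>Taken as a polynomial in C and D, so that weight and derivative are immediate; the eta
  product is recovered in \<open>Delta_q_product\<close>.\<close>

definition Delta_q :: "complex \<Rightarrow> complex" where
  "Delta_q q = D_q q * (C_q q ^ 2 - 64 * D_q q)"

text \<open>Eliminating the derivatives at q and q^2 from three relations leaves a purely algebraic
  one. It is equivalent to 5 C(q)^2 = E4(q) + 4 E4(q^2).\<close>

lemma square_relation:
  assumes "norm q < 1"
  shows "-6 * (4 * lsum 1 1 (q ^ 2) - lsum 1 1 q) ^ 2 = -48 * lsum 1 1 (q ^ 2) ^ 2 + 6 * lsum 1 1 q ^ 2
    - 4 * lsum 1 3 (q ^ 2) - lsum 1 3 q - 2 * lsum 1 1 (q ^ 2) + lsum 1 1 q"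
proof -
  note r = lsum_relation_2[OF assms] lsum_relation_2[OF norm_square_less_one[OF assms]]
    alternating_lsum_relation_2[OF assms, unfolded lsum_alternating[OF assms]]
  have "- 4 * (4 * lsum 1 1 (q ^ 2) - lsum 1 1 q) ^ 2
      = 2 * (8 * lsum2 1 2 (q ^ 2) - lsum2 1 2 q) - (16 * lsum 1 3 (q ^ 2) - lsum 1 3 q) - (4 * lsum 1 1 (q ^ 2) - lsum 1 1 q)"
    using r(3) by simp
  with r(1,2) show ?thesis by algebra
qed

lemma theta_relations:
  assumes q: "norm q < 1"
  defines "a \<equiv> lsum 1 1 q" and "b \<equiv> lsum 1 1 (q ^ 2)" and "c \<equiv> lsum 1 3 q" and "d \<equiv> lsum 1 3 (q ^ 2)"
    and "a' \<equiv> lsum2 1 2 q" and "b' \<equiv> lsum2 1 2 (q ^ 2)" and "c' \<equiv> lsum2 1 4 q" and "d' \<equiv> lsum2 1 4 (q ^ 2)"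
  shows "-6 * (4 * b - a) ^ 2 = -48 * b ^ 2 + 6 * a ^ 2 - 4 * d - c - 2 * b + a"
    and "6 * a' = 5 * c + a - 12 * a ^ 2"
    and "6 * b' = 5 * d + b - 12 * b ^ 2"
    and "c' - 2 * d' = (1 - 32 * b + 8 * a) * (c - d)"
proof -
  define e f where "e = lsum 1 5 q" and "f = lsum 1 5 (q ^ 2)"
  note q2 = norm_square_less_one[OF q]
  have rel: "-6 * (4 * b - a) ^ 2 = -48 * b ^ 2 + 6 * a ^ 2 - 4 * d - c - 2 * b + a"
    using square_relation[OF q] by (simp add: a_def b_def c_def d_def)
  have ra: "6 * a' = 5 * c + a - 12 * a ^ 2"
    unfolding a_def a'_def c_def by (rule lsum_relation_2[OF q])
  have rb: "6 * b' = 5 * d + b - 12 * b ^ 2"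
    unfolding b_def b'_def d_def by (rule lsum_relation_2[OF q2])
  have rc: "30 * c' = 21 * e + 10 * c - a - 240 * a * c"
    unfolding a_def c'_def e_def c_def by (rule lsum_relation_4[OF q])
  have rd: "30 * d' = 21 * f + 10 * d - b - 240 * b * d"
    unfolding b_def d'_def f_def d_def by (rule lsum_relation_4[OF q2])
  have rm: "-16 * (4 * b - a) * (16 * d - c) = 2 * (32 * d' - c') - (64 * f - e) - 2 * (16 * d - c) + (4 * b - a)"
    using alternating_lsum_relation_4[OF q] unfolding lsum_alternating[OF q]
    by (simp add: a_def b_def c_def d_def c'_def d'_def e_def f_def)
  note t = has_theta_lsum[OF q, of 1] has_theta_lsum[OF q, of 3]
  \<comment> \<open>Applying q d/dq to both sides of \<open>square_relation\<close> and using
    uniqueness supplies one more linear relation between c' and d'.\<close>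
  have "has_theta (\<lambda>q. -6 * (4 * lsum 1 1 (q ^ 2) - lsum 1 1 q) ^ 2)
      (-6 * (of_nat 2 * (4 * b - a) ^ (2 - 1) * (4 * (2 * b') - a'))) q"
    using t unfolding a_def b_def a'_def b'_def by (intro has_theta_cmult has_theta_power has_theta_diff) (simp_all add: numeral_2_eq_2)
  moreover have "has_theta (\<lambda>q. -48 * lsum 1 1 (q ^ 2) ^ 2 + 6 * lsum 1 1 q ^ 2
    - 4 * lsum 1 3 (q ^ 2) - lsum 1 3 q - 2 * lsum 1 1 (q ^ 2) + lsum 1 1 q)
    (-48 * (of_nat 2 * b ^ (2 - 1) * (2 * b')) + 6 * (of_nat 2 * a ^ (2 - 1) * a') - 4 * (2 * d') - c' - 2 * (2 * b') + a') q"
    using t unfolding a_def b_def a'_def b'_def c'_def d'_def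
    by (intro has_theta_add has_theta_diff has_theta_cmult has_theta_power) (simp_all add: eval_nat_numeral)
  ultimately have "-6 * (of_nat 2 * (4 * b - a) ^ (2 - 1) * (4 * (2 * b') - a'))
    = -48 * (of_nat 2 * b ^ (2 - 1) * (2 * b')) + 6 * (of_nat 2 * a ^ (2 - 1) * a') - 4 * (2 * d') - c' - 2 * (2 * b') + a'"
    by (intro has_theta_unique[OF has_theta_transform[OF _ q square_relation]])
  then have rt: "-12 * (4 * b - a) * (8 * b' - a') = -192 * b * b' + 12 * a * a' - 8 * d' - c' - 4 * b' + a'"
    by (simp add: algebra_simps)
  show "-6 * (4 * b - a) ^ 2 = -48 * b ^ 2 + 6 * a ^ 2 - 4 * d - c - 2 * b + a" by (rule rel)
  show "6 * a' = 5 * c + a - 12 * a ^ 2" by (rule ra)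
  show "6 * b' = 5 * d + b - 12 * b ^ 2" by (rule rb)
  \<comment> \<open>\<open>rc\<close>, \<open>rd\<close>, \<open>rm\<close> and \<open>rt\<close>
    are linear in c', d', e, f. Removing e and f leaves two independent equations, which determine
    c' and d'. The factor 1 - 32 b + 8 a is (E2A + C) / 2.\<close>
  show "c' - 2 * d' = (1 - 32 * b + 8 * a) * (c - d)"
    using rel ra rb rc rd rm rt by algebra
qed

lemma has_theta_C_q:
  assumes "norm q < 1"
  shows "has_theta C_q ((E2A_q q * C_q q - G_q q) / 4) q"
proof -
  note t = has_theta_lsum[OF assms, of 1] and r = theta_relations[OF assms]
  have "has_theta C_q (0 + 24 * lsum2 1 2 q - 48 * (2 * lsum2 1 2 (q ^ 2))) q"
    unfolding C_q_def[abs_def] using t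
    by (intro has_theta_add has_theta_diff has_theta_cmult has_theta_const) (simp_all add: numeral_2_eq_2)
  moreover have "4 * (0 + 24 * lsum2 1 2 q - 48 * (2 * lsum2 1 2 (q ^ 2))) = E2A_q q * C_q q - G_q q"
    unfolding E2A_q_def C_q_def G_q_def D_q_def using r(1,2,3) by algebra
  ultimately show ?thesis by (metis nonzero_mult_div_cancel_left zero_neq_numeral)
qed

lemma has_theta_E2A_q:
  assumes "norm q < 1"
  shows "has_theta E2A_q ((E2A_q q ^ 2 - C_q q ^ 2) / 8) q"
proof -
  note t = has_theta_lsum[OF assms, of 1] and r = theta_relations[OF assms]
  have "has_theta E2A_q (0 - 8 * lsum2 1 2 q - 16 * (2 * lsum2 1 2 (q ^ 2))) q"
    unfolding E2A_q_def[abs_def] using t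
    by (intro has_theta_add has_theta_diff has_theta_cmult has_theta_const) (simp_all add: numeral_2_eq_2)
  moreover have "8 * (0 - 8 * lsum2 1 2 q - 16 * (2 * lsum2 1 2 (q ^ 2))) = E2A_q q ^ 2 - C_q q ^ 2"
    unfolding E2A_q_def C_q_def G_q_def D_q_def using r(1,2,3) by algebra
  ultimately show ?thesis by (metis nonzero_mult_div_cancel_left zero_neq_numeral)
qed

lemma has_theta_D_q:
  assumes "norm q < 1"
  shows "has_theta D_q ((E2A_q q + C_q q) / 2 * D_q q) q"
proof -
  note t = has_theta_lsum[OF assms, of 3] and r = theta_relations[OF assms]
  have "has_theta D_q (lsum2 1 4 q - 2 * lsum2 1 4 (q ^ 2)) q"
    unfolding D_q_def[abs_def] using t by (intro has_theta_diff) (simp_all add: eval_nat_numeral)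
  then show ?thesis
    by (rule has_theta_eqI) (unfold r(4), simp add: D_q_def E2A_q_def C_q_def field_simps)
qed

text \<open>The factors D and C^2 - 64 D have logarithmic derivatives (E2A + C) / 2 and (E2A - C) /
  2 with respect to q d/dq.\<close>

lemma has_theta_Delta_q:
  assumes "norm q < 1"
  shows "has_theta Delta_q (E2A_q q * Delta_q q) q"
proof -
  note t = has_theta_D_q[OF assms] has_theta_C_q[OF assms]
  have "has_theta Delta_q ((E2A_q q + C_q q) / 2 * D_q q * (C_q q ^ 2 - 64 * D_q q)
      + D_q q * (of_nat 2 * C_q q ^ (2 - 1) * ((E2A_q q * C_q q - G_q q) / 4) - 64 * ((E2A_q q + C_q q) / 2 * D_q q))) q"
    unfolding Delta_q_def[abs_def]
    by (intro has_theta_mult has_theta_diff has_theta_power has_theta_cmult t)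
  then show ?thesis
    by (rule has_theta_eqI) (simp add: G_q_def Delta_q_def field_simps power2_eq_square)
qed

lemma has_theta_G_q:
  assumes "norm q < 1"
  shows "has_theta G_q ((E2A_q q * G_q q - C_q q ^ 3) / 2) q"
proof -
  note t = has_theta_D_q[OF assms] has_theta_C_q[OF assms]
  have "has_theta G_q (of_nat 2 * C_q q ^ (2 - 1) * ((E2A_q q * C_q q - G_q q) / 4) - 128 * ((E2A_q q + C_q q) / 2 * D_q q)) q"
    unfolding G_q_def[abs_def]
    by (intro has_theta_diff has_theta_power has_theta_cmult t[unfolded G_q_def])
  then show ?thesis
    by (rule has_theta_eqI) (simp add: G_q_def field_simps power2_eq_square power3_eq_cube)
qed


section \<open>Identification of D and Delta with the eta products\<close>

lemma holomorphic_on_ball_square: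
  assumes "f holomorphic_on ball 0 1"
  shows "(\<lambda>q. f (q ^ 2)) holomorphic_on ball (0 :: complex) 1"
proof -
  have "f \<circ> (\<lambda>q. q ^ 2) holomorphic_on ball 0 1"
    by (rule holomorphic_on_compose_gen[OF _ assms]) (auto intro!: holomorphic_intros norm_square_less_one)
  then show ?thesis by (simp add: o_def)
qed

lemma holomorphic_forms [holomorphic_intros]:
  "E2A_q holomorphic_on ball 0 1" "C_q holomorphic_on ball 0 1" "D_q holomorphic_on ball 0 1"
  "G_q holomorphic_on ball 0 1" "Delta_q holomorphic_on ball 0 1"
proof -
  note [holomorphic_intros] = holomorphic_on_ball_square[OF lsum_holomorphic[OF norm_one]] lsum_holomorphic[OF norm_one]
  show e: "E2A_q holomorphic_on ball 0 1" and c [holomorphic_intros]: "C_q holomorphic_on ball 0 1"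
    and x [holomorphic_intros]: "D_q holomorphic_on ball 0 1"
    unfolding E2A_q_def[abs_def] C_q_def[abs_def] D_q_def[abs_def] by (intro holomorphic_intros)+
  show "G_q holomorphic_on ball 0 1" "Delta_q holomorphic_on ball 0 1"
    unfolding G_q_def[abs_def] Delta_q_def[abs_def] by (intro holomorphic_intros)+
qed

lemma lsum_0 [simp]: "lsum s j 0 = 0"
  unfolding lsum_def by (rule infsum_0) (auto simp: lterm_def)

lemma C_q_0 [simp]: "C_q 0 = 1"
  by (simp add: C_q_def)

lemma D_q_0 [simp]: "D_q 0 = 0"
  by (simp add: D_q_def)

text \<open>Normalisation: a logarithmic derivative determines a function only up to a scalar, and
  the coefficient of q fixes that scalar.\<close>

lemma D_q_derivative_0: "(D_q has_field_derivative 1) (at 0)"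
proof -
  obtain D where D: "(lsum 1 3 has_field_derivative D) (at 0)" "D = 1"
    by (rule lsum_derivative[of 0 1 3]) auto
  have "((\<lambda>q. lsum 1 3 (q ^ 2)) has_field_derivative (D * 0)) (at 0)"
    by (rule DERIV_chain2[where f = "lsum 1 3" and g = "\<lambda>q. q ^ 2"])
      (use D in \<open>auto intro!: derivative_eq_intros\<close>)
  from DERIV_diff[OF D(1) this] D(2) show ?thesis
    by (simp add: D_q_def[abs_def])
qed

lemma Delta_q_derivative_0: "(Delta_q has_field_derivative 1) (at 0)"
proof -
  have "C_q field_differentiable at 0"
    using holomorphic_on_imp_differentiable_at[OF holomorphic_forms(2) open_ball, of 0] by simp
  then obtain C' where "(C_q has_field_derivative C') (at 0)" by (auto simp: field_differentiable_def)
  then show ?thesis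
    unfolding Delta_q_def[abs_def] using D_q_derivative_0
    by (auto intro!: derivative_eq_intros)
qed

text \<open>The quotient \<open>W = f / p\<close> satisfies \<open>q W' = W\<close>, so \<open>W'\<close> is constant.\<close>

lemma euler_equation_unique:
  assumes f: "f holomorphic_on ball 0 1" and p: "p holomorphic_on ball 0 1"
    and p0: "\<And>q. norm q < 1 \<Longrightarrow> p q \<noteq> 0"
    and tf: "\<And>q. norm q < 1 \<Longrightarrow> has_theta f (w q * f q) q"
    and tp: "\<And>q. norm q < 1 \<Longrightarrow> has_theta p ((w q - 1) * p q) q"
    and f': "(f has_field_derivative 1) (at 0)" and p1: "p 0 = 1"
    and q: "norm q < 1"
  shows "f q = q * p q"
proof -
  define W where "W = (\<lambda>q. f q / p q)"
  have W: "W holomorphic_on ball 0 1"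
    unfolding W_def using p0 by (intro holomorphic_intros f p) auto
  have tW: "has_theta W (W q) q" if "norm q < 1" for q
    unfolding W_def using has_theta_divide[OF tf[OF that] tp[OF that] p0[OF that]] p0[OF that]
    by (rule_tac has_theta_eqI) (auto simp: field_simps)
  have WD: "q * deriv W q = W q" if "norm q < 1" for q
    by (rule has_theta_unique[OF has_theta_deriv[OF W that] tW[OF that]])
  have D: "deriv W holomorphic_on ball 0 1"
    using W by (rule holomorphic_deriv) simp
  \<comment> \<open>Differentiating q W' = W gives q W'' = 0, hence W'' = 0 away from the origin;
    continuity of W' bridges the exceptional point 0.\<close>
  have "(deriv W has_field_derivative 0) (at q)" if "q \<in> ball 0 1 - {0}" for q
  proof -
    have q: "norm q < 1" "q \<noteq> 0" using that by auto
    have q': "q \<in> ball 0 1" using q by simp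
    have d: "(deriv W has_field_derivative deriv (deriv W) q) (at q)"
      by (rule holomorphic_derivI[OF D open_ball q'])
    have "((\<lambda>q. q * deriv W q) has_field_derivative (1 * deriv W q + deriv (deriv W) q * q)) (at q)"
      by (rule DERIV_mult[OF DERIV_ident d])
    then have "(W has_field_derivative (1 * deriv W q + deriv (deriv W) q * q)) (at q)"
      by (rule has_field_derivative_transform_within_open[OF _ open_ball q']) (simp add: WD)
    from DERIV_unique[OF this holomorphic_derivI[OF W open_ball q']]
    have "deriv (deriv W) q = 0" using q by simp
    then show ?thesis using d by simp
  qed
  then obtain c where c: "\<And>q. q \<in> ball 0 1 \<Longrightarrow> deriv W q = c"
    using DERIV_zero_connected_constant[OF _ open_ball _ holomorphic_on_imp_continuous_on[OF D], of "{0}"]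
    by (metis connected_ball finite.emptyI finite_insert)
  \<comment> \<open>The constant is W'(0) = f'(0) / p(0) = 1.\<close>
  have "f 0 = 0" using WD[of 0] p1 by (simp add: W_def)
  moreover obtain p' where "(p has_field_derivative p') (at 0)"
    using holomorphic_on_imp_differentiable_at[OF p open_ball, of 0] by (auto simp: field_differentiable_def)
  ultimately have "(W has_field_derivative 1) (at 0)"
    unfolding W_def using f' p1 by (auto intro!: derivative_eq_intros)
  then have "c = 1" using c[of 0] DERIV_imp_deriv[of W 1 0] by simp
  then have "W q = q" using WD[OF q] c[of q] q by simp
  then show ?thesis using p0[OF q] by (simp add: W_def field_simps)
qed

lemma has_theta_euler_phi:
  assumes "norm q < 1"
  shows "has_theta euler_phi (- lsum 1 1 q * euler_phi q) q"
    and "has_theta (\<lambda>q. euler_phi (q ^ 2)) (- 2 * lsum 1 1 (q ^ 2) * euler_phi (q ^ 2)) q"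
proof -
  have *: "has_theta euler_phi (- lsum 1 1 q * euler_phi q) q" if "norm q < 1" for q
    unfolding has_theta_def using euler_phi_derivative[OF that] by blast
  show "has_theta euler_phi (- lsum 1 1 q * euler_phi q) q" by (rule *[OF assms])
  show "has_theta (\<lambda>q. euler_phi (q ^ 2)) (- 2 * lsum 1 1 (q ^ 2) * euler_phi (q ^ 2)) q"
    by (rule has_theta_eqI[OF has_theta_square[OF *[OF norm_square_less_one[OF assms]]]]) simp
qed

lemma has_theta_power_log:
  assumes "has_theta f (t * f q) q"
  shows "has_theta (\<lambda>q. f q ^ n) (of_nat n * t * f q ^ n) q"
  by (rule has_theta_eqI[OF has_theta_power[OF assms]]) (cases n; simp)

text \<open>The logarithmic derivative of the product is -8 \<open>lsum 1 1 q\<close> - 16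
  \<open>lsum 1 1 (q ^ 2)\<close>, that is E2A - 1; the factor q supplies the missing 1.\<close>

lemma Delta_q_product:
  assumes "norm q < 1"
  shows "Delta_q q = q * (euler_phi q ^ 8 * euler_phi (q ^ 2) ^ 8)"
proof (rule euler_equation_unique[where f = Delta_q and w = E2A_q and p = "\<lambda>q. euler_phi q ^ 8 * euler_phi (q ^ 2) ^ 8"])
  show "(\<lambda>q. euler_phi q ^ 8 * euler_phi (q ^ 2) ^ 8) holomorphic_on ball 0 1"
    by (intro holomorphic_intros holomorphic_on_ball_square[OF euler_phi_holomorphic])
  show "has_theta (\<lambda>q. euler_phi q ^ 8 * euler_phi (q ^ 2) ^ 8)
      ((E2A_q q - 1) * (euler_phi q ^ 8 * euler_phi (q ^ 2) ^ 8)) q" if "norm q < 1" for q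
    by (rule has_theta_eqI[OF has_theta_mult[OF has_theta_power_log[OF has_theta_euler_phi(1)[OF that]]
          has_theta_power_log[OF has_theta_euler_phi(2)[OF that]]]])
      (simp add: E2A_q_def algebra_simps)
qed (use assms in \<open>auto simp: euler_phi_nonzero norm_square_less_one holomorphic_forms has_theta_Delta_q Delta_q_derivative_0\<close>)

text \<open>Here the product contributes 8 \<open>lsum 1 1 q\<close> - 32
  \<open>lsum 1 1 (q ^ 2)\<close>, that is (E2A + C) / 2 - 1.\<close>

lemma D_q_product:
  assumes "norm q < 1"
  shows "D_q q = q * (euler_phi (q ^ 2) ^ 16 / euler_phi q ^ 8)"
proof (rule euler_equation_unique[where f = D_q and w = "\<lambda>q. (E2A_q q + C_q q) / 2"
      and p = "\<lambda>q. euler_phi (q ^ 2) ^ 16 / euler_phi q ^ 8"])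
  show "(\<lambda>q. euler_phi (q ^ 2) ^ 16 / euler_phi q ^ 8) holomorphic_on ball 0 1"
    by (intro holomorphic_intros holomorphic_on_ball_square[OF euler_phi_holomorphic]) (simp add: euler_phi_nonzero)
  show "has_theta (\<lambda>q. euler_phi (q ^ 2) ^ 16 / euler_phi q ^ 8)
      (((E2A_q q + C_q q) / 2 - 1) * (euler_phi (q ^ 2) ^ 16 / euler_phi q ^ 8)) q" if "norm q < 1" for q
  proof -
    have nz: "euler_phi q ^ 8 \<noteq> 0" using euler_phi_nonzero[OF that] by simp
    show ?thesis
      by (rule has_theta_eqI[OF has_theta_divide[OF has_theta_power_log[OF has_theta_euler_phi(2)[OF that]]
            has_theta_power_log[OF has_theta_euler_phi(1)[OF that]] nz]])
        (use nz in \<open>simp add: E2A_q_def C_q_def divide_simps\<close>, simp add: algebra_simps)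
  qed
qed (use assms has_theta_D_q in \<open>auto simp: euler_phi_nonzero norm_square_less_one holomorphic_forms D_q_derivative_0\<close>)

section \<open>The three-term recurrence and the differential equation\<close>

text \<open>By \<open>has_theta_C_q\<close> this is C' / 24.\<close>

definition K_q :: "complex \<Rightarrow> complex" where
  "K_q q = (E2A_q q * C_q q - G_q q) / 96"

text \<open>The recurrence of P and Q homogenised by powers of a root s of Delta: only s^2 = Delta
  remains. The agreement with \<open>F_form\<close> is \<open>F_form_via_nome\<close>.\<close>

fun F_q :: "nat \<Rightarrow> complex \<Rightarrow> complex" where
  "F_q 0 q = K_q q"
| "F_q (Suc 0) q = G_q q * K_q q - Delta_q q"
| "F_q (Suc (Suc n)) q = G_q q * F_q (Suc n) q + lam (Suc n) * Delta_q q * F_q n q"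

definition H_q :: "nat \<Rightarrow> complex \<Rightarrow> complex" where
  "H_q n q = F_q (Suc n) q - G_q q * F_q n q"

lemma H_q_0: "H_q 0 q = - Delta_q q"
  by (simp add: H_q_def)

lemma H_q_Suc: "H_q (Suc n) q = lam (Suc n) * Delta_q q * F_q n q"
  by (simp add: H_q_def)

text \<open>The derivative times C equals ((E2A C - G)^2 + C^4 - G^2) / 256, where E2A C - G = 96 K
  and C^4 - G^2 = 256 Delta. This is the ladder relation at n = 0.\<close>

lemma has_theta_K_q:
  assumes "norm q < 1"
  obtains t where "has_theta K_q t q" "C_q q * t = 36 * K_q q ^ 2 + Delta_q q"
proof
  let ?t = "1 / 96 * ((E2A_q q ^ 2 - C_q q ^ 2) / 8 * C_q q + E2A_q q * ((E2A_q q * C_q q - G_q q) / 4) - (E2A_q q * G_q q - C_q q ^ 3) / 2)"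
  have *: "K_q = (\<lambda>q. 1 / 96 * (E2A_q q * C_q q - G_q q))" by (simp add: fun_eq_iff K_q_def)
  show "has_theta K_q ?t q"
    unfolding * by (intro has_theta_cmult has_theta_diff has_theta_mult has_theta_E2A_q has_theta_C_q has_theta_G_q assms)
  show "C_q q * ?t = 36 * K_q q ^ 2 + Delta_q q"
    by (simp add: K_q_def Delta_q_def G_q_def field_simps power2_eq_square power3_eq_cube)
qed

text \<open>
  Ladder relations: \<open>H_q n\<close> stands for \<open>\<lambda>\<^sub>n \<Delta> F\<^sub>n\<^sub>-\<^sub>1\<close>, and at \<open>n = 0\<close>, where \<open>\<lambda>\<^sub>0\<close> is infinite,
  for \<open>- \<Delta>\<close>. The factor \<open>96 K + G\<close> is \<open>C E\<^sub>2\<^sub>A\<close>.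
\<close>

lemma ladder:
  assumes q: "norm q < 1"
  shows "\<exists>t u. has_theta (F_q n) t q \<and> has_theta (H_q n) u q
    \<and> C_q q * t = 12 * (4 * of_nat n + 3) * K_q q * F_q n q - (of_nat n + 1) * H_q n q
    \<and> C_q q * u = H_q n q * (96 * K_q q + G_q q + 12 * (4 * of_nat n - 1) * K_q q + of_nat n * G_q q)
        - 4 * ((4 * of_nat n + 1) * (4 * of_nat n + 3)) / (of_nat n + 1) * Delta_q q * F_q n q"
proof (induction n)
  case 0
  obtain t where t: "has_theta K_q t q" "C_q q * t = 36 * K_q q ^ 2 + Delta_q q"
    using has_theta_K_q[OF q] by blast
  have F0: "F_q 0 = K_q" and H0: "H_q 0 = (\<lambda>q. -1 * Delta_q q)" by (auto simp: fun_eq_iff H_q_0)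
  have "has_theta (H_q 0) (-1 * (E2A_q q * Delta_q q)) q"
    unfolding H0 by (intro has_theta_cmult has_theta_Delta_q q)
  \<comment> \<open>E2A C = 96 K + G is split as (84 K + G) + 12 K, because at n = 0 the bracket
    contains -12 K and the coefficient of Delta F_0 is 12.\<close>
  moreover have "C_q q * (-1 * (E2A_q q * Delta_q q)) = - Delta_q q * (84 * K_q q + G_q q) - 12 * Delta_q q * K_q q"
    by (simp add: K_q_def field_simps)
  then have "C_q q * (-1 * (E2A_q q * Delta_q q)) = H_q 0 q * (96 * K_q q + G_q q + 12 * (4 * of_nat 0 - 1) * K_q q + of_nat 0 * G_q q)
      - 4 * ((4 * of_nat 0 + 1) * (4 * of_nat 0 + 3)) / (of_nat 0 + 1) * Delta_q q * F_q 0 q"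
    by (simp add: H_q_0)
  moreover have "C_q q * t = 12 * (4 * of_nat 0 + 3) * K_q q * F_q 0 q - (of_nat 0 + 1) * H_q 0 q"
    using t(2) by (simp add: H_q_0 power2_eq_square)
  moreover have "has_theta (F_q 0) t q" using t(1) by (simp only: F0)
  ultimately show ?case by blast
next
  case (Suc n)
  then obtain t u where t: "has_theta (F_q n) t q" and u: "has_theta (H_q n) u q"
    and ct: "C_q q * t = 12 * (4 * of_nat n + 3) * K_q q * F_q n q - (of_nat n + 1) * H_q n q"
    and cu: "C_q q * u = H_q n q * (96 * K_q q + G_q q + 12 * (4 * of_nat n - 1) * K_q q + of_nat n * G_q q)
        - 4 * ((4 * of_nat n + 1) * (4 * of_nat n + 3)) / (of_nat n + 1) * Delta_q q * F_q n q" by blast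
  let ?t = "(E2A_q q * G_q q - C_q q ^ 3) / 2 * F_q n q + G_q q * t + u"
  let ?u = "lam (Suc n) * ((E2A_q q * Delta_q q) * F_q n q + Delta_q q * t)"
  define N where "N = complex_of_nat n"
  have N: "N + 1 \<noteq> 0" "N + 2 \<noteq> 0"
    unfolding N_def using of_nat_neq_0[of n, where ?'a = complex] of_nat_neq_0[of "Suc n", where ?'a = complex]
    by (simp_all add: algebra_simps)
  \<comment> \<open>The recurrence as a first-order system for the pair (F_n, H_n), so both
    components are differentiated from the previous pair alone.\<close>
  have FS: "F_q (Suc n) = (\<lambda>q. G_q q * F_q n q + H_q n q)" and HS: "H_q (Suc n) = (\<lambda>q. lam (Suc n) * (Delta_q q * F_q n q))"
    by (auto simp: fun_eq_iff H_q_def)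
  have "has_theta (F_q (Suc n)) ?t q"
    unfolding FS by (intro has_theta_add has_theta_mult has_theta_G_q q t u)
  moreover have "has_theta (H_q (Suc n)) ?u q"
    unfolding HS by (intro has_theta_cmult has_theta_mult has_theta_Delta_q q t)
  moreover have lam: "(N + 1) * (N + 2) * lam (Suc n) = 4 * ((4 * N + 5) * (4 * N + 7))"
  proof -
    have "complex_of_nat (Suc n) = N + 1" "N + 1 + 1 = N + 2" "4 * (N + 1) + 1 = 4 * N + 5" "4 * (N + 1) + 3 = 4 * N + 7"
      by (simp_all add: N_def)
    then have "lam (Suc n) = 4 * ((4 * N + 5) * (4 * N + 7)) / ((N + 1) * (N + 2))"
      by (simp only: lam_def)
    then show ?thesis using N by simp
  qed
  have eC: "C_q q * E2A_q q = 96 * K_q q + G_q q" by (simp add: K_q_def field_simps)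
  \<comment> \<open>Squaring G = C^2 - 128 D gives C^4 - 256 D (C^2 - 64 D).\<close>
  have GD: "G_q q ^ 2 = C_q q ^ 4 - 256 * Delta_q q" 
    by (simp add: G_q_def Delta_q_def algebra_simps power2_eq_square power4_eq_xxxx)
  have cu': "(N + 1) * (C_q q * u) = (N + 1) * H_q n q * (96 * K_q q + G_q q + 12 * (4 * N - 1) * K_q q + N * G_q q)
        - 4 * ((4 * N + 1) * (4 * N + 3)) * Delta_q q * F_q n q"
    using cu N by (simp add: N_def field_simps)
  \<comment> \<open>The factors N + 1 and 2 clear the denominators of \<open>cu\<close> and of the
    derivative of G. The value of \<lambda> enters through 32 (N + 1) + (4 N + 1) (4 N + 3) = (4 N +
    5) (4 N + 7), the first summand coming from \<open>GD\<close>.\<close>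
  have "(N + 1) * (C_q q * ?t) = (N + 1) * (12 * (4 * (N + 1) + 3) * K_q q * F_q (Suc n) q - (N + 2) * H_q (Suc n) q)"
  proof -
    have "(N + 1) * (2 * (C_q q * ?t)) = (N + 1) * ((96 * K_q q + G_q q) * G_q q - C_q q ^ 4) * F_q n q
        + 2 * (N + 1) * G_q q * (12 * (4 * N + 3) * K_q q * F_q n q - (N + 1) * H_q n q)
        + 2 * ((N + 1) * (C_q q * u))"
      unfolding ct[folded N_def, symmetric] eC[symmetric] by (simp add: field_simps eval_nat_numeral)
    also have "\<dots> = 2 * ((N + 1) * 12 * (4 * (N + 1) + 3) * K_q q * F_q (Suc n) q - (N + 1) * (N + 2) * lam (Suc n) * Delta_q q * F_q n q)"
      unfolding cu' lam FS using GD by algebra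
    finally show ?thesis unfolding H_q_Suc by algebra
  qed
  then have "C_q q * ?t = 12 * (4 * (N + 1) + 3) * K_q q * F_q (Suc n) q - (N + 2) * H_q (Suc n) q"
    using N by simp
  moreover have "(N + 2) * (C_q q * ?u) = (N + 2) * (H_q (Suc n) q * (96 * K_q q + G_q q + 12 * (4 * (N + 1) - 1) * K_q q + (N + 1) * G_q q))
        - 4 * ((4 * (N + 1) + 1) * (4 * (N + 1) + 3)) * Delta_q q * F_q (Suc n) q"
  proof -
    have *: "C_q q * ?u = lam (Suc n) * Delta_q q * ((96 * K_q q + G_q q) * F_q n q + (12 * (4 * N + 3) * K_q q * F_q n q - (N + 1) * H_q n q))"
      unfolding ct[folded N_def, symmetric] eC[symmetric] by (simp add: algebra_simps)
    have **: "4 * ((4 * (N + 1) + 1) * (4 * (N + 1) + 3)) = (N + 1) * (N + 2) * lam (Suc n)"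
      unfolding lam by (simp add: algebra_simps)
    show ?thesis
      unfolding * ** FS H_q_Suc by algebra
  qed
  then have "C_q q * ?u = H_q (Suc n) q * (96 * K_q q + G_q q + 12 * (4 * (N + 1) - 1) * K_q q + (N + 1) * G_q q)
        - 4 * ((4 * (N + 1) + 1) * (4 * (N + 1) + 3)) / (N + 2) * Delta_q q * F_q (Suc n) q"
    using N by (simp add: field_simps)
  moreover have "complex_of_nat (Suc n) = N + 1" "complex_of_nat (Suc n) + 1 = N + 2" by (simp_all add: N_def)
  ultimately show ?case by (intro exI[of _ ?t] exI[of _ ?u]) (simp only:)
qed

lemma K_q_holomorphic [holomorphic_intros]: "K_q holomorphic_on ball 0 1"
  unfolding K_q_def[abs_def] by (intro holomorphic_intros) auto

lemma F_q_holomorphic [holomorphic_intros]: "F_q n holomorphic_on ball 0 1"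
proof (induction n rule: induct_nat_012)
  case 0
  show ?case by (simp add: holomorphic_intros cong: holomorphic_cong)
next
  case 1
  show ?case by (simp, intro holomorphic_intros)
next
  case (ge2 n)
  then show ?case by (simp, intro holomorphic_intros)
qed

text \<open>For k = 4 n + 3 the coefficients (k + 1) / 4 and k (k + 1) / 8 are n + 1 and (4 n + 3)
  (n + 1) / 2, and E2A' is replaced by (E2A^2 - C^2) / 8. One factor C comes from the ladder
  relation, another from its derivative.\<close>

lemma F_q_equation_times_square:
  fixes n :: nat
  assumes q: "norm q < 1"
  defines "F' \<equiv> \<lambda>q. q * deriv (F_q n) q"
  shows "C_q q ^ 2 * (q * deriv F' q - (of_nat n + 1) * E2A_q q * F' q
    + (4 * of_nat n + 3) * (of_nat n + 1) / 2 * ((E2A_q q ^ 2 - C_q q ^ 2) / 8) * F_q n q) = 0"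
proof -
  define N where "N = complex_of_nat n"
  have N: "N + 1 \<noteq> 0" unfolding N_def using of_nat_neq_0[of n, where ?'a = complex] by (simp add: add.commute)
  have F'_hol: "F' holomorphic_on ball 0 1"
    unfolding F'_def by (intro holomorphic_intros holomorphic_deriv) auto
  have tF: "has_theta (F_q n) (F' q) q" if "norm q < 1" for q
    unfolding F'_def by (rule has_theta_deriv[OF F_q_holomorphic that])
  \<comment> \<open>Stated throughout the disc and not only at the given point, since it is
    differentiated next.\<close>
  have CF': "12 * (4 * N + 3) * (K_q q * F_q n q) - (N + 1) * H_q n q = C_q q * F' q" if "norm q < 1" for q
  proof -
    obtain t where "has_theta (F_q n) t q"
      "C_q q * t = 12 * (4 * of_nat n + 3) * K_q q * F_q n q - (of_nat n + 1) * H_q n q"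
      using ladder[of q n] \<open>norm q < 1\<close> by blast
    then show ?thesis using has_theta_unique[OF tF[OF that]] by (simp add: N_def mult.assoc)
  qed
  obtain u where u: "has_theta (H_q n) u q"
    and cu: "C_q q * u = H_q n q * (96 * K_q q + G_q q + 12 * (4 * N - 1) * K_q q + N * G_q q)
        - 4 * ((4 * N + 1) * (4 * N + 3)) / (N + 1) * Delta_q q * F_q n q"
    using ladder[OF q, of n] unfolding N_def by blast
  have cu': "(N + 1) * (C_q q * u) = (N + 1) * H_q n q * (96 * K_q q + G_q q + 12 * (4 * N - 1) * K_q q + N * G_q q)
        - 4 * ((4 * N + 1) * (4 * N + 3)) * Delta_q q * F_q n q"
    using cu N by (simp add: field_simps)
  obtain k where k: "has_theta K_q k q" and ck: "C_q q * k = 36 * K_q q ^ 2 + Delta_q q"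
    using has_theta_K_q[OF q] by blast
  have "has_theta (\<lambda>q. 12 * (4 * N + 3) * (K_q q * F_q n q) - (N + 1) * H_q n q)
      (12 * (4 * N + 3) * (k * F_q n q + K_q q * F' q) - (N + 1) * u) q"
    by (intro has_theta_diff has_theta_cmult has_theta_mult k u tF q)
  from has_theta_unique[OF has_theta_transform[OF this q CF']
      has_theta_mult[OF has_theta_C_q[OF q] has_theta_deriv[OF F'_hol q]]]
  have "12 * (4 * N + 3) * (k * F_q n q + K_q q * F' q) - (N + 1) * u
      = (E2A_q q * C_q q - G_q q) / 4 * F' q + C_q q * (q * deriv F' q)" .
  then have second: "12 * (4 * N + 3) * (k * F_q n q + K_q q * F' q) - (N + 1) * u
      = 24 * K_q q * F' q + C_q q * (q * deriv F' q)"
    by (simp add: K_q_def)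
  have eC: "C_q q * E2A_q q = 96 * K_q q + G_q q" by (simp add: K_q_def field_simps)
  have GD: "G_q q ^ 2 = C_q q ^ 4 - 256 * Delta_q q"
    by (simp add: G_q_def Delta_q_def algebra_simps power2_eq_square power4_eq_xxxx)
  \<comment> \<open>H and the derivatives of K and H are eliminated by \<open>CF'\<close>,
    \<open>ck\<close> and \<open>cu'\<close>; the factor 16 clears the denominators 2 and 8.\<close>
  have "16 * (C_q q ^ 2 * (q * deriv F' q)) - 16 * (N + 1) * (C_q q * E2A_q q) * (C_q q * F' q)
    + (4 * N + 3) * (N + 1) * ((C_q q * E2A_q q) ^ 2 - C_q q ^ 4) * F_q n q = 0"
    using second cu' ck eC GD CF'[OF q] by algebra
  then have "16 * (C_q q ^ 2 * (q * deriv F' q - (N + 1) * E2A_q q * F' q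
    + (4 * N + 3) * (N + 1) / 2 * ((E2A_q q ^ 2 - C_q q ^ 2) / 8) * F_q n q)) = 0"
    by (simp add: field_simps power2_eq_square power4_eq_xxxx)
  then show ?thesis by (simp add: N_def)
qed

text \<open>\<open>C\<close> has zeros in the disc, but it is not identically zero, so the factor \<open>C\<^sup>2\<close> can be cancelled.\<close>

lemma F_q_equation:
  fixes n :: nat
  assumes q: "norm q < 1"
  defines "F' \<equiv> \<lambda>q. q * deriv (F_q n) q"
  shows "q * deriv F' q - (of_nat n + 1) * E2A_q q * F' q
    + (4 * of_nat n + 3) * (of_nat n + 1) / 2 * ((E2A_q q ^ 2 - C_q q ^ 2) / 8) * F_q n q = 0"
proof -
  define L where "L = (\<lambda>q. q * deriv F' q - (of_nat n + 1) * E2A_q q * F' q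
    + (4 * of_nat n + 3) * (of_nat n + 1) / 2 * ((E2A_q q ^ 2 - C_q q ^ 2) / 8) * F_q n q)"
  have F'_hol [holomorphic_intros]: "F' holomorphic_on ball 0 1"
    unfolding F'_def by (intro holomorphic_intros holomorphic_deriv) auto
  have "L holomorphic_on ball 0 1"
    unfolding L_def by (intro holomorphic_intros holomorphic_deriv) auto
  then have cont: "continuous_on (ball 0 1) L" by (rule holomorphic_on_imp_continuous_on)
  have CL: "C_q z = 0 \<or> L z = 0" if "norm z < 1" for z
    using F_q_equation_times_square[OF that, of n] by (simp add: L_def F'_def)
  have "L q = 0"
  proof (rule ccontr)
    assume nz: "L q \<noteq> 0"
    \<comment> \<open>If L were nonzero at q, then C would vanish on this open neighbourhood of q,
      hence on the whole disc, against C(0) = 1.\<close>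
    let ?U = "L -` (- {0}) \<inter> ball 0 1"
    have "open ?U" using continuous_open_preimage[OF cont open_ball, of "- {0}"] by (simp add: Int_commute open_Compl)
    moreover have "q \<in> ?U" using nz q by simp
    moreover have "C_q z = 0" if "z \<in> ?U" for z using CL[of z] that by auto
    ultimately have "C_q 0 = 0"
      by (intro analytic_continuation_open[of ?U "ball 0 1" C_q "\<lambda>_. 0" 0])
        (auto simp: holomorphic_forms)
    then show False by simp
  qed
  then show ?thesis by (simp add: L_def)
qed


section \<open>Passage to the upper half-plane\<close>

lemma norm_nome: "\<tau> \<in> upper_half_plane \<Longrightarrow> norm (nome \<tau>) < 1"
  by (simp add: upper_half_plane_def nome_def)

lemma nome_double: "nome (2 * \<tau>) = nome \<tau> ^ 2"
  by (simp add: nome_def mult_ac flip: exp_of_nat_mult)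

lemma double_in_upper_half_plane: "\<tau> \<in> upper_half_plane \<Longrightarrow> 2 * \<tau> \<in> upper_half_plane"
  by (simp add: upper_half_plane_def)

lemma open_upper_half_plane: "open upper_half_plane"
  unfolding upper_half_plane_def by (rule open_halfspace_Im_gt)

lemma E2_eq: "\<tau> \<in> upper_half_plane \<Longrightarrow> E2 \<tau> = 1 - 24 * lsum 1 1 (nome \<tau>)"
  unfolding E2_def by (simp only: sums_unique[OF divisor_sum_series[OF norm_nome], symmetric])

lemma dedekind_eta_eq: "dedekind_eta \<tau> = exp (2 * of_real pi * \<i> * \<tau> / 24) * euler_phi (nome \<tau>)"
  by (simp add: dedekind_eta_def euler_phi_def)

lemma forms_via_nome:
  assumes "\<tau> \<in> upper_half_plane"
  shows "E2A \<tau> = E2A_q (nome \<tau>)" and "C_form \<tau> = C_q (nome \<tau>)" and "D_form \<tau> = D_q (nome \<tau>)"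
    and "Delta2A \<tau> = Delta_q (nome \<tau>)" and "G_form \<tau> = G_q (nome \<tau>)"
proof -
  note q = norm_nome[OF assms]
  define z where "z = 2 * complex_of_real pi * \<i> * \<tau>"
  have eta: "dedekind_eta \<tau> = exp (z / 24) * euler_phi (nome \<tau>)"
    "dedekind_eta (2 * \<tau>) = exp (z / 12) * euler_phi (nome \<tau> ^ 2)"
    by (simp_all add: dedekind_eta_eq nome_double z_def)
  show "E2A \<tau> = E2A_q (nome \<tau>)" and C: "C_form \<tau> = C_q (nome \<tau>)"
    unfolding E2A_def C_form_def E2A_q_def C_q_def E2_eq[OF assms] E2_eq[OF double_in_upper_half_plane[OF assms]] nome_double
    by (simp_all add: field_simps)
  \<comment> \<open>Exponents of the eta prefactors: 16/12 = 1 + 8/24 for D and 8/24 + 8/12 = 1 for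
    Delta, so exactly one factor q remains.\<close>
  have e: "exp (z / 12) ^ 16 = nome \<tau> * exp (z / 24) ^ 8" "exp (z / 24) ^ 8 * exp (z / 12) ^ 8 = nome \<tau>"
    by (simp_all add: nome_def z_def[symmetric] flip: exp_of_nat_mult exp_add)
  have "D_form \<tau> = (exp (z / 12) ^ 16 / exp (z / 24) ^ 8) * (euler_phi (nome \<tau> ^ 2) ^ 16 / euler_phi (nome \<tau>) ^ 8)"
    by (simp add: D_form_def eta power_mult_distrib)
  then show D: "D_form \<tau> = D_q (nome \<tau>)"
    by (simp add: e(1) D_q_product[OF q])
  have "Delta2A \<tau> = (exp (z / 24) ^ 8 * exp (z / 12) ^ 8) * (euler_phi (nome \<tau>) ^ 8 * euler_phi (nome \<tau> ^ 2) ^ 8)"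
    by (simp add: Delta2A_def eta power_mult_distrib)
  then show "Delta2A \<tau> = Delta_q (nome \<tau>)"
    by (simp add: e(2) Delta_q_product[OF q])
  show "G_form \<tau> = G_q (nome \<tau>)"
    by (simp add: G_form_def G_q_def C D)
qed

text \<open>Convergent products of nonzero factors do not vanish; this makes division by a square
  root of Delta legitimate.\<close>

lemma Delta2A_nonzero: "\<tau> \<in> upper_half_plane \<Longrightarrow> Delta2A \<tau> \<noteq> 0"
  by (simp add: Delta2A_def dedekind_eta_eq euler_phi_nonzero norm_nome double_in_upper_half_plane)

text \<open>The derivative of q = exp(2 pi i \<tau>) is 2 pi i q, so the normalised derivative in
  \<tau> is q d/dq.\<close>

lemma qderiv_via_nome:
  assumes F: "\<And>\<tau>. \<tau> \<in> upper_half_plane \<Longrightarrow> F \<tau> = f (nome \<tau>)"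
    and f: "has_theta f t (nome \<tau>)" and \<tau>: "\<tau> \<in> upper_half_plane"
  shows "F field_differentiable at \<tau>" and "qderiv F \<tau> = t"
proof -
  obtain D where D: "(f has_field_derivative D) (at (nome \<tau>))" "nome \<tau> * D = t"
    using f by (auto simp: has_theta_def)
  have "(nome has_field_derivative (2 * of_real pi * \<i> * nome \<tau>)) (at \<tau>)"
    unfolding nome_def[abs_def] by (auto intro!: derivative_eq_intros)
  from DERIV_chain2[where g = nome, OF D(1) this]
  have "((\<lambda>\<tau>. f (nome \<tau>)) has_field_derivative (2 * of_real pi * \<i> * t)) (at \<tau>)"
    unfolding D(2)[symmetric] by (simp add: mult_ac)
  then have *: "(F has_field_derivative (2 * of_real pi * \<i> * t)) (at \<tau>)"
    by (rule has_field_derivative_transform_within_open[OF _ open_upper_half_plane \<tau>]) (simp add: F)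
  then show "F field_differentiable at \<tau>" by (auto simp: field_differentiable_def)
  show "qderiv F \<tau> = t" unfolding qderiv_def DERIV_imp_deriv[OF *] by simp
qed

lemma F_form_via_nome:
  assumes "\<tau> \<in> upper_half_plane"
  shows "F_form n \<tau> = F_q n (nome \<tau>)"
proof -
  \<comment> \<open>The induction runs at a fixed \<tau>, where s is a single nonzero number with
    s^2 = Delta.\<close>
  define s where "s = csqrt (Delta2A \<tau>)"
  have s: "s \<noteq> 0" "s ^ 2 = Delta_q (nome \<tau>)"
    using Delta2A_nonzero[OF assms] forms_via_nome(4)[OF assms] by (auto simp: s_def)
  have K: "qderiv C_form \<tau> / 24 = K_q (nome \<tau>)"
    by (simp add: qderiv_via_nome(2)[OF forms_via_nome(2) has_theta_C_q[OF norm_nome] assms] assms K_q_def)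
  have "s ^ n * poly (P_poly n) (G_q (nome \<tau>) / s) * K_q (nome \<tau>) - s ^ (n + 1) * poly (Q_poly n) (G_q (nome \<tau>) / s)
      = F_q n (nome \<tau>)"
  proof (induction n rule: induct_nat_012)
    case (ge2 n)
    show ?case
      unfolding F_q.simps(3) ge2[symmetric] s(2)[symmetric] using s(1)
      by (simp add: field_simps power2_eq_square)
  qed (use s in \<open>simp_all add: power2_eq_square\<close>)
  then show ?thesis
    unfolding F_form_def F_expr_def K s_def[symmetric] forms_via_nome(5)[OF assms] .
qed

section \<open>Closure properties of the graded ring and the weight of the forms\<close>

lemma quasimodular_cong:
  assumes "\<And>\<tau>. \<tau> \<in> upper_half_plane \<Longrightarrow> f \<tau> = g \<tau>"
  shows "quasimodular_form_Gamma0_2 w f \<longleftrightarrow> quasimodular_form_Gamma0_2 w g"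
  unfolding quasimodular_form_Gamma0_2_def using assms by simp

lemma quasimodular_one: "quasimodular_form_Gamma0_2 0 (\<lambda>_. 1)"
proof -
  have "{(a, b, c). 2 * a + 2 * b + 4 * c = (0 :: nat)} = {(0, 0, 0)}" by auto
  then show ?thesis
    unfolding quasimodular_form_Gamma0_2_def by (intro exI[of _ "\<lambda>_. 1"]) (auto simp: case_prod_unfold)
qed

lemma quasimodular_add:
  assumes "quasimodular_form_Gamma0_2 w f" "quasimodular_form_Gamma0_2 w g"
  shows "quasimodular_form_Gamma0_2 w (\<lambda>\<tau>. f \<tau> + g \<tau>)"
proof -
  obtain c d where "\<forall>\<tau>\<in>upper_half_plane. f \<tau> = (\<Sum>(i, j, k) | 2 * i + 2 * j + 4 * k = w.
                 c (i, j, k) * E2 \<tau> ^ i * C_form \<tau> ^ j * D_form \<tau> ^ k)"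
    "\<forall>\<tau>\<in>upper_half_plane. g \<tau> = (\<Sum>(i, j, k) | 2 * i + 2 * j + 4 * k = w.
                 d (i, j, k) * E2 \<tau> ^ i * C_form \<tau> ^ j * D_form \<tau> ^ k)"
    using assms unfolding quasimodular_form_Gamma0_2_def by blast
  then show ?thesis
    unfolding quasimodular_form_Gamma0_2_def
    by (intro exI[of _ "\<lambda>x. c x + d x"])
      (simp add: sum.distrib[symmetric] case_prod_unfold distrib_right)
qed

lemma quasimodular_cmult:
  assumes "quasimodular_form_Gamma0_2 w f"
  shows "quasimodular_form_Gamma0_2 w (\<lambda>\<tau>. z * f \<tau>)"
proof -
  obtain c where "\<forall>\<tau>\<in>upper_half_plane. f \<tau> = (\<Sum>(i, j, k) | 2 * i + 2 * j + 4 * k = w.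
                 c (i, j, k) * E2 \<tau> ^ i * C_form \<tau> ^ j * D_form \<tau> ^ k)"
    using assms unfolding quasimodular_form_Gamma0_2_def by blast
  then show ?thesis
    unfolding quasimodular_form_Gamma0_2_def
    by (intro exI[of _ "\<lambda>x. z * c x"]) (simp add: sum_distrib_left case_prod_unfold mult.assoc)
qed

text \<open>Multiplication by a monomial shifts exponents, so the coefficients are shifted and
  extended by zero. With sums and scalar multiples this covers multiplication by G and Delta. The
  separate equation for v leaves weights to arithmetic.\<close>

lemma quasimodular_mult_monomial:
  assumes "quasimodular_form_Gamma0_2 w f" and v: "v = w + (2 * i + 2 * j + 4 * k)"
  shows "quasimodular_form_Gamma0_2 v (\<lambda>\<tau>. E2 \<tau> ^ i * C_form \<tau> ^ j * D_form \<tau> ^ k * f \<tau>)"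
proof -
  obtain c where c: "\<And>\<tau>. \<tau> \<in> upper_half_plane \<Longrightarrow> f \<tau> = (\<Sum>(i, j, k) | 2 * i + 2 * j + 4 * k = w.
                 c (i, j, k) * E2 \<tau> ^ i * C_form \<tau> ^ j * D_form \<tau> ^ k)"
    using assms unfolding quasimodular_form_Gamma0_2_def by blast
  define d where "d = (\<lambda>(a, b, e). if i \<le> a \<and> j \<le> b \<and> k \<le> e then c (a - i, b - j, e - k) else 0)"
  show ?thesis
    unfolding quasimodular_form_Gamma0_2_def
  proof (intro exI[of _ d] ballI)
    fix \<tau> assume \<tau>: "\<tau> \<in> upper_half_plane"
    let ?S = "{(a, b, e). 2 * a + 2 * b + 4 * e = v}"
    let ?T = "{(a, b, e). 2 * a + 2 * b + 4 * e = v \<and> i \<le> a \<and> j \<le> b \<and> k \<le> e}"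
    let ?g = "\<lambda>(a, b, e). d (a, b, e) * E2 \<tau> ^ a * C_form \<tau> ^ b * D_form \<tau> ^ e"
    have "sum ?g ?S = sum ?g ?T"
      by (rule sum.mono_neutral_right) (auto simp: finite_monomials_of_degree d_def split: if_splits)
    also have "\<dots> = (\<Sum>(a, b, e) | 2 * a + 2 * b + 4 * e = w.
        E2 \<tau> ^ i * C_form \<tau> ^ j * D_form \<tau> ^ k * (c (a, b, e) * E2 \<tau> ^ a * C_form \<tau> ^ b * D_form \<tau> ^ e))"
    proof (rule sum.reindex_bij_witness[where i = "\<lambda>(a, b, e). (a + i, b + j, e + k)"
            and j = "\<lambda>(a, b, e). (a - i, b - j, e - k)"])
      fix x assume "x \<in> ?T"
      then obtain a b e where x: "x = (a + i, b + j, e + k)" "2 * a + 2 * b + 4 * e = w"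
        using v by (auto simp: le_iff_add ac_simps)
      then show "(case (case x of (a, b, e) \<Rightarrow> (a - i, b - j, e - k)) of (a, b, e) \<Rightarrow>
          E2 \<tau> ^ i * C_form \<tau> ^ j * D_form \<tau> ^ k * (c (a, b, e) * E2 \<tau> ^ a * C_form \<tau> ^ b * D_form \<tau> ^ e)) = ?g x"
        by (simp add: d_def power_add mult_ac)
    qed (use v in auto)
    also have "\<dots> = E2 \<tau> ^ i * C_form \<tau> ^ j * D_form \<tau> ^ k * f \<tau>"
      unfolding c[OF \<tau>] by (simp add: sum_distrib_left case_prod_unfold)
    finally show "E2 \<tau> ^ i * C_form \<tau> ^ j * D_form \<tau> ^ k * f \<tau> = sum ?g ?S" by simp
  qed
qed

lemma quasimodular_monomial:
  assumes "v = 2 * i + 2 * j + 4 * k"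
  shows "quasimodular_form_Gamma0_2 v (\<lambda>\<tau>. E2 \<tau> ^ i * C_form \<tau> ^ j * D_form \<tau> ^ k)"
  using quasimodular_mult_monomial[OF quasimodular_one, of v i j k] assms by simp

lemma quasimodular_mult_G:
  assumes "quasimodular_form_Gamma0_2 w f"
  shows "quasimodular_form_Gamma0_2 (w + 4) (\<lambda>\<tau>. G_form \<tau> * f \<tau>)"
proof -
  have "quasimodular_form_Gamma0_2 (w + 4) (\<lambda>\<tau>. E2 \<tau> ^ 0 * C_form \<tau> ^ 2 * D_form \<tau> ^ 0 * f \<tau>
      + (- 128) * (E2 \<tau> ^ 0 * C_form \<tau> ^ 0 * D_form \<tau> ^ 1 * f \<tau>))"
    by (intro quasimodular_add quasimodular_cmult quasimodular_mult_monomial[OF assms]) auto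
  then show ?thesis by (simp add: G_form_def algebra_simps)
qed

lemma Delta2A_polynomial:
  "\<tau> \<in> upper_half_plane \<Longrightarrow> Delta2A \<tau> = D_form \<tau> * C_form \<tau> ^ 2 - 64 * D_form \<tau> ^ 2"
  by (simp add: forms_via_nome Delta_q_def algebra_simps power2_eq_square)

lemma quasimodular_mult_Delta2A:
  assumes "quasimodular_form_Gamma0_2 w f"
  shows "quasimodular_form_Gamma0_2 (w + 8) (\<lambda>\<tau>. Delta2A \<tau> * f \<tau>)"
proof -
  have "quasimodular_form_Gamma0_2 (w + 8) (\<lambda>\<tau>. E2 \<tau> ^ 0 * C_form \<tau> ^ 2 * D_form \<tau> ^ 1 * f \<tau>
      + (- 64) * (E2 \<tau> ^ 0 * C_form \<tau> ^ 0 * D_form \<tau> ^ 2 * f \<tau>))"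
    by (intro quasimodular_add quasimodular_cmult quasimodular_mult_monomial[OF assms]) auto
  then show ?thesis
    by (rule quasimodular_cong[THEN iffD1, rotated]) (simp add: Delta2A_polynomial algebra_simps)
qed

text \<open>Substituting 3 E2A = 2 E2 + C and G = C^2 - 128 D into K gives E2 C / 144 - C^2 / 144 +
  4 D / 3.\<close>

lemma quasimodular_K: "quasimodular_form_Gamma0_2 4 (\<lambda>\<tau>. K_q (nome \<tau>))"
proof -
  have "quasimodular_form_Gamma0_2 4 (\<lambda>\<tau>. 1 / 144 * (E2 \<tau> ^ 1 * C_form \<tau> ^ 1 * D_form \<tau> ^ 0)
      + ((- 1 / 144) * (E2 \<tau> ^ 0 * C_form \<tau> ^ 2 * D_form \<tau> ^ 0)
      + 4 / 3 * (E2 \<tau> ^ 0 * C_form \<tau> ^ 0 * D_form \<tau> ^ 1)))"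
    by (intro quasimodular_add quasimodular_cmult quasimodular_monomial) auto
  then show ?thesis
  proof (rule quasimodular_cong[THEN iffD1, rotated])
    fix \<tau> assume \<tau>: "\<tau> \<in> upper_half_plane"
    have "3 * E2A_q (nome \<tau>) = 2 * E2 \<tau> + C_q (nome \<tau>)"
      by (simp add: E2_eq[OF \<tau>] E2A_q_def C_q_def)
    then have e: "E2A_q (nome \<tau>) = (2 * E2 \<tau> + C_q (nome \<tau>)) / 3" by (simp add: field_simps)
    show "1 / 144 * (E2 \<tau> ^ 1 * C_form \<tau> ^ 1 * D_form \<tau> ^ 0)
      + ((- 1 / 144) * (E2 \<tau> ^ 0 * C_form \<tau> ^ 2 * D_form \<tau> ^ 0)
      + 4 / 3 * (E2 \<tau> ^ 0 * C_form \<tau> ^ 0 * D_form \<tau> ^ 1)) = K_q (nome \<tau>)"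
      unfolding forms_via_nome[OF \<tau>] K_q_def G_q_def e by (simp add: field_simps power2_eq_square)
  qed
qed

lemma quasimodular_F_q: "quasimodular_form_Gamma0_2 (4 * n + 4) (\<lambda>\<tau>. F_q n (nome \<tau>))"
proof (induction n rule: induct_nat_012)
  case 0
  show ?case using quasimodular_K by simp
next
  case 1
  have "quasimodular_form_Gamma0_2 8 (\<lambda>\<tau>. G_form \<tau> * K_q (nome \<tau>) + (-1) * (Delta2A \<tau> * 1))"
    using quasimodular_mult_G[OF quasimodular_K] quasimodular_mult_Delta2A[OF quasimodular_one]
    by (intro quasimodular_add quasimodular_cmult) simp_all
  then have "quasimodular_form_Gamma0_2 8 (\<lambda>\<tau>. F_q (Suc 0) (nome \<tau>))"
    by (rule quasimodular_cong[THEN iffD1, rotated]) (simp add: forms_via_nome)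
  then show ?case by simp
next
  case (ge2 n)
  have "quasimodular_form_Gamma0_2 (4 * n + 12) (\<lambda>\<tau>. G_form \<tau> * F_q (Suc n) (nome \<tau>)
      + lam (Suc n) * (Delta2A \<tau> * F_q n (nome \<tau>)))"
    using quasimodular_mult_G[OF ge2(2)] quasimodular_mult_Delta2A[OF ge2(1)]
    by (intro quasimodular_add quasimodular_cmult) (simp_all add: algebra_simps)
  then have "quasimodular_form_Gamma0_2 (4 * n + 12) (\<lambda>\<tau>. F_q (Suc (Suc n)) (nome \<tau>))"
    by (rule quasimodular_cong[THEN iffD1, rotated]) (simp add: forms_via_nome)
  then show ?case by (simp add: algebra_simps)
qed

theorem mainTheorem1:
  fixes n k :: nat
  assumes "k = 4 * n + 3"
  shows "quasimodular_form_Gamma0_2 (k + 1) (F_form n) \<and>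
    F_form n holomorphic_on upper_half_plane \<and>
    (\<forall>\<tau>\<in>upper_half_plane.
       qderiv (qderiv (F_form n)) \<tau>
       - (of_nat k + 1) / 4 * E2A \<tau> * qderiv (F_form n) \<tau>
       + of_nat k * (of_nat k + 1) / 8 * qderiv E2A \<tau> * F_form n \<tau> = 0)"
proof (intro conjI ballI)
  have "quasimodular_form_Gamma0_2 (4 * n + 4) (F_form n)"
    using quasimodular_F_q by (rule quasimodular_cong[THEN iffD1, rotated]) (simp add: F_form_via_nome)
  then show "quasimodular_form_Gamma0_2 (k + 1) (F_form n)" using assms by (simp add: add.commute)
  define F' where "F' = (\<lambda>q. q * deriv (F_q n) q)"
  have F': "F' holomorphic_on ball 0 1"
    unfolding F'_def by (intro holomorphic_intros holomorphic_deriv) auto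
  have F: "F_form n field_differentiable at \<tau>" "qderiv (F_form n) \<tau> = F' (nome \<tau>)" if "\<tau> \<in> upper_half_plane" for \<tau>
    unfolding F'_def
    by (rule qderiv_via_nome[OF F_form_via_nome has_theta_deriv[OF F_q_holomorphic norm_nome[OF that]] that]; simp)+
  \<comment> \<open>\<open>deriv\<close> is a total function, so differentiability is established in
    its own right alongside the equation.\<close>
  show "F_form n holomorphic_on upper_half_plane"
    by (rule holomorphic_onI) (rule field_differentiable_at_within[OF F(1)])
  fix \<tau> assume \<tau>: "\<tau> \<in> upper_half_plane"
  have "qderiv (qderiv (F_form n)) \<tau> = nome \<tau> * deriv F' (nome \<tau>)"
    by (rule qderiv_via_nome(2)[OF F(2) has_theta_deriv[OF F' norm_nome[OF \<tau>]] \<tau>])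
  moreover have "qderiv E2A \<tau> = (E2A_q (nome \<tau>) ^ 2 - C_q (nome \<tau>) ^ 2) / 8"
    by (rule qderiv_via_nome(2)[OF forms_via_nome(1) has_theta_E2A_q[OF norm_nome[OF \<tau>]] \<tau>])
  moreover have "of_nat k = 4 * complex_of_nat n + 3" using assms by simp
  then have "(of_nat k + 1) / 4 = complex_of_nat n + 1"
    "of_nat k * (of_nat k + 1) / 8 = (4 * complex_of_nat n + 3) * (of_nat n + 1) / 2"
    by (simp_all add: field_simps)
  ultimately show "qderiv (qderiv (F_form n)) \<tau>
       - (of_nat k + 1) / 4 * E2A \<tau> * qderiv (F_form n) \<tau>
       + of_nat k * (of_nat k + 1) / 8 * qderiv E2A \<tau> * F_form n \<tau> = 0"
    using F_q_equation[OF norm_nome[OF \<tau>], of n] F(2)[OF \<tau>] F_form_via_nome[OF \<tau>] forms_via_nome(1)[OF \<tau>]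
    by (simp only: F'_def)
qed

end
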